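(* Suppose that $A$ is a commutative ring, $f \in A$ is a nonzero divisor and $A \to B$ is a faithfully flat ring homomorphism (in particular, the images of $f$ in $B$ and $B \otimes_A B$, again denoted $f$, are again nonzero divisors). Then $$0 \to \underline{M}\mathcal{O}(A, f) \to \underline{M}\mathcal{O}(B, f) \to \underline{M}\mathcal{O}(B \otimes_A B, f)$$ is exact, where the last map is the difference of the two maps induced by $b \mapsto b \otimes 1$ and $b \mapsto 1 \otimes b$.
   Context: For a commutative ring $A$ and a nonzero divisor $f \in A$, define the $A$-submodule $\underline{M}\mathcal{O}(A,f) := \{ a/f \in A[f^{-1}] : a \in \sqrt{(f)} \subseteq A \}$ of $A[f^{-1}]$. A ring homomorphism $\phi: A \to B$ with nonzero divisors $f \in A$, $g \in B$ such that $\phi(f)$ divides $g$ induces a map $\underline{M}\mathcal{O}(A,f) \to \underline{M}\mathcal{O}(B,g)$ by restricting $A[f^{-1}] \to B[g^{-1}]$. *)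

theory Defs
  imports "HOL-Algebra.Module" "HOL-Algebra.Ideal" "HOL-Algebra.Free_Abelian_Groups"
begin

definition nonzero_divisor :: "('a, 'm) ring_scheme \<Rightarrow> 'a \<Rightarrow> bool" where
  "nonzero_divisor R f \<longleftrightarrow>
     f \<in> carrier R \<and> (\<forall>a \<in> carrier R. f \<otimes>\<^bsub>R\<^esub> a = \<zero>\<^bsub>R\<^esub> \<longrightarrow> a = \<zero>\<^bsub>R\<^esub>)"

definition radical :: "('a, 'm) ring_scheme \<Rightarrow> 'a set \<Rightarrow> 'a set" where
  "radical R I = {a \<in> carrier R. \<exists>n::nat. n > 0 \<and> a [^]\<^bsub>R\<^esub> n \<in> I}"

subsection \<open>Modules and exact sequences\<close>

definition linear_maps ::
    "('a, 'r) ring_scheme \<Rightarrow> ('a, 'm) module \<Rightarrow> ('a, 'n) module \<Rightarrow> ('m \<Rightarrow> 'n) set" where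
  "linear_maps R M N =
     {u \<in> hom (add_monoid M) (add_monoid N).
        \<forall>a \<in> carrier R. \<forall>x \<in> carrier M. u (a \<odot>\<^bsub>M\<^esub> x) = a \<odot>\<^bsub>N\<^esub> u x}"

text \<open>Exactness at the middle term of a sequence of linear maps between modules.
  (\<open>exact_seq\<close> of \<open>HOL-Algebra\<close> needs all carriers to have the same type.)\<close>

definition exact ::
    "('a, 'r) ring_scheme \<Rightarrow> ('a, 'l) module \<Rightarrow> ('a, 'm) module \<Rightarrow> ('a, 'n) module \<Rightarrow>
     ('l \<Rightarrow> 'm) \<Rightarrow> ('m \<Rightarrow> 'n) \<Rightarrow> bool" where
  "exact R L M N u v \<longleftrightarrow>
     module R L \<and> module R M \<and> module R N \<and>
     u \<in> linear_maps R L M \<and> v \<in> linear_maps R M N \<and>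
     u ` carrier L = kernel (add_monoid M) (add_monoid N) v"

definition zero_module :: "('a, unit) module" where
  "zero_module = \<lparr>carrier = {()}, monoid.mult = (\<lambda>_ _. ()), one = (), ring.zero = (), add = (\<lambda>_ _. ()),
                  smult = (\<lambda>_ _. ())\<rparr>"

definition algebra_of :: "('a \<Rightarrow> 'b) \<Rightarrow> ('b, 'm) ring_scheme \<Rightarrow> ('a, 'b) module" where
  "algebra_of \<phi> B =
     \<lparr>carrier = carrier B, monoid.mult = monoid.mult B, one = \<one>\<^bsub>B\<^esub>, ring.zero = \<zero>\<^bsub>B\<^esub>, add = add B,
      smult = (\<lambda>a b. \<phi> a \<otimes>\<^bsub>B\<^esub> b)\<rparr>"

definition restrict_scalars :: "('a \<Rightarrow> 'b) \<Rightarrow> ('b, 'm) module \<Rightarrow> ('a, 'm) module" where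
  "restrict_scalars \<phi> M =
     \<lparr>carrier = carrier M, monoid.mult = monoid.mult M, one = \<one>\<^bsub>M\<^esub>, ring.zero = \<zero>\<^bsub>M\<^esub>, add = add M,
      smult = (\<lambda>a x. \<phi> a \<odot>\<^bsub>M\<^esub> x)\<rparr>"

subsection \<open>Tensor products\<close>

definition tensor_relators ::
    "('a, 'r) ring_scheme \<Rightarrow> ('a, 'm) module \<Rightarrow> ('a, 'n) module \<Rightarrow> ('m \<times> 'n \<Rightarrow>\<^sub>0 int) set" where
  "tensor_relators R M N =
     {frag_of (x \<oplus>\<^bsub>M\<^esub> x', y) - frag_of (x, y) - frag_of (x', y) | x x' y.
        x \<in> carrier M \<and> x' \<in> carrier M \<and> y \<in> carrier N} \<union>
     {frag_of (x, y \<oplus>\<^bsub>N\<^esub> y') - frag_of (x, y) - frag_of (x, y') | x y y'.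
        x \<in> carrier M \<and> y \<in> carrier N \<and> y' \<in> carrier N} \<union>
     {frag_of (a \<odot>\<^bsub>M\<^esub> x, y) - frag_of (x, a \<odot>\<^bsub>N\<^esub> y) | a x y.
        a \<in> carrier R \<and> x \<in> carrier M \<and> y \<in> carrier N}"

definition tensor_class ::
    "('a, 'r) ring_scheme \<Rightarrow> ('a, 'm) module \<Rightarrow> ('a, 'n) module \<Rightarrow>
     ('m \<times> 'n \<Rightarrow>\<^sub>0 int) \<Rightarrow> ('m \<times> 'n \<Rightarrow>\<^sub>0 int) set" where
  "tensor_class R M N c =
     (let F = free_Abelian_group (carrier M \<times> carrier N)
      in generate F (tensor_relators R M N) #>\<^bsub>F\<^esub> c)"

text \<open>The free abelian group on \<open>carrier M \<times> carrier N\<close> modulo the bilinearity relations.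
  Operations on classes are unions over representatives; all members of such a union coincide.
  The fields \<open>mult\<close> and \<open>one\<close>, with \<open>(x \<otimes> y)(x' \<otimes> y') = xx' \<otimes> yy'\<close>, are meaningful only if
  \<open>M\<close> and \<open>N\<close> are commutative algebras, and make the tensor product an algebra in that case.\<close>

definition tensor ::
    "('a, 'r) ring_scheme \<Rightarrow> ('a, 'm) module \<Rightarrow> ('a, 'n) module \<Rightarrow>
     ('a, ('m \<times> 'n \<Rightarrow>\<^sub>0 int) set) module" where
  "tensor R M N =
     (let F = free_Abelian_group (carrier M \<times> carrier N);
          Q = F Mod generate F (tensor_relators R M N)
      in \<lparr>carrier = carrier Q,
          monoid.mult = (\<lambda>C D. \<Union>c\<in>C. \<Union>d\<in>D. tensor_class R M N
            (frag_extend (\<lambda>(x, y). frag_extend (\<lambda>(x', y').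
               frag_of (x \<otimes>\<^bsub>M\<^esub> x', y \<otimes>\<^bsub>N\<^esub> y')) d) c)),
          one = tensor_class R M N (frag_of (\<one>\<^bsub>M\<^esub>, \<one>\<^bsub>N\<^esub>)),
          ring.zero = \<one>\<^bsub>Q\<^esub>,
          add = monoid.mult Q,
          smult = (\<lambda>a C. \<Union>c\<in>C. tensor_class R M N
            (frag_extend (\<lambda>(x, y). frag_of (a \<odot>\<^bsub>M\<^esub> x, y)) c))\<rparr>)"

definition pure_tensor ::
    "('a, 'r) ring_scheme \<Rightarrow> ('a, 'm) module \<Rightarrow> ('a, 'n) module \<Rightarrow> 'm \<Rightarrow> 'n \<Rightarrow>
     ('m \<times> 'n \<Rightarrow>\<^sub>0 int) set" where
  "pure_tensor R M N x y = tensor_class R M N (frag_of (x, y))"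

text \<open>The map \<open>id \<otimes> u : M \<otimes> N \<rightarrow> M \<otimes> N'\<close> induced by \<open>u : N \<rightarrow> N'\<close>.\<close>

definition tensor_map ::
    "('a, 'r) ring_scheme \<Rightarrow> ('a, 'm) module \<Rightarrow> ('a, 'n) module \<Rightarrow> ('n0 \<Rightarrow> 'n) \<Rightarrow>
     ('m \<times> 'n0 \<Rightarrow>\<^sub>0 int) set \<Rightarrow> ('m \<times> 'n \<Rightarrow>\<^sub>0 int) set" where
  "tensor_map R M N' u C =
     (\<Union>c\<in>C. tensor_class R M N' (frag_extend (\<lambda>(x, y). frag_of (x, u y)) c))"

subsection \<open>Faithful flatness\<close>

text \<open>A module \<open>M\<close> is faithfully flat if a complex \<open>N1 \<rightarrow> N2 \<rightarrow> N3\<close> is exact iff its tensor product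
  with \<open>M\<close> is. HOL cannot quantify over all types, so the carriers of the \<open>Ni\<close> range over
  subsets of a type \<open>'u\<close>, which has to be chosen large enough.\<close>

definition faithfully_flat ::
    "'u itself \<Rightarrow> ('a, 'r) ring_scheme \<Rightarrow> ('a, 'm) module \<Rightarrow> bool" where
  "faithfully_flat (_ :: 'u itself) R M \<longleftrightarrow>
     module R M \<and>
     (\<forall>(N1 :: ('a, 'u) module) (N2 :: ('a, 'u) module) (N3 :: ('a, 'u) module) u v.
        module R N1 \<and> module R N2 \<and> module R N3 \<and>
        u \<in> linear_maps R N1 N2 \<and> v \<in> linear_maps R N2 N3 \<and>
        (\<forall>x \<in> carrier N1. v (u x) = \<zero>\<^bsub>N3\<^esub>) \<longrightarrow>
        (exact R N1 N2 N3 u v \<longleftrightarrow>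
         exact R (tensor R M N1) (tensor R M N2) (tensor R M N3)
           (tensor_map R M N2 u) (tensor_map R M N3 v)))"

text \<open>The type \<open>('a + 'b) set\<close> contains isomorphic copies of all subquotients of \<open>A\<close> and \<open>B\<close>.
  Hence the condition below is the usual one: \<open>B\<close> is flat as soon as \<open>B \<otimes> I \<rightarrow> B \<otimes> A\<close> is injective for
  all ideals \<open>I\<close> of \<open>A\<close>, and a flat \<open>B\<close> is faithfully flat as soon as \<open>B \<otimes> A/m \<noteq> 0\<close> for all maximal
  ideals \<open>m\<close>.\<close>

definition faithfully_flat_hom ::
    "('a, 'r) ring_scheme \<Rightarrow> ('b, 's) ring_scheme \<Rightarrow> ('a \<Rightarrow> 'b) \<Rightarrow> bool" where
  "faithfully_flat_hom A B \<phi> \<longleftrightarrow>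
     \<phi> \<in> ring_hom A B \<and> faithfully_flat TYPE(('a + 'b) set) A (algebra_of \<phi> B)"

subsection \<open>The localization at the powers of an element\<close>

definition powers :: "('a, 'r) ring_scheme \<Rightarrow> 'a \<Rightarrow> 'a set" where
  "powers R f = range (\<lambda>n::nat. f [^]\<^bsub>R\<^esub> n)"

definition frac_rel :: "('a, 'r) ring_scheme \<Rightarrow> 'a \<Rightarrow> (('a \<times> 'a) \<times> ('a \<times> 'a)) set" where
  "frac_rel R f =
     {((a, s), (b, t)). a \<in> carrier R \<and> b \<in> carrier R \<and> s \<in> powers R f \<and> t \<in> powers R f \<and>
        (\<exists>u \<in> powers R f. u \<otimes>\<^bsub>R\<^esub> (a \<otimes>\<^bsub>R\<^esub> t) = u \<otimes>\<^bsub>R\<^esub> (b \<otimes>\<^bsub>R\<^esub> s))}"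

definition frac :: "('a, 'r) ring_scheme \<Rightarrow> 'a \<Rightarrow> 'a \<Rightarrow> 'a \<Rightarrow> ('a \<times> 'a) set" where
  "frac R f a s = frac_rel R f `` {(a, s)}"

definition localization :: "('a, 'r) ring_scheme \<Rightarrow> 'a \<Rightarrow> ('a, ('a \<times> 'a) set) module" where
  "localization R f =
     \<lparr>carrier = (carrier R \<times> powers R f) // frac_rel R f,
      monoid.mult = (\<lambda>C D. \<Union>(a, s)\<in>C. \<Union>(b, t)\<in>D. frac R f (a \<otimes>\<^bsub>R\<^esub> b) (s \<otimes>\<^bsub>R\<^esub> t)),
      one = frac R f \<one>\<^bsub>R\<^esub> \<one>\<^bsub>R\<^esub>,
      ring.zero = frac R f \<zero>\<^bsub>R\<^esub> \<one>\<^bsub>R\<^esub>,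
      add = (\<lambda>C D. \<Union>(a, s)\<in>C. \<Union>(b, t)\<in>D.
        frac R f ((a \<otimes>\<^bsub>R\<^esub> t) \<oplus>\<^bsub>R\<^esub> (b \<otimes>\<^bsub>R\<^esub> s)) (s \<otimes>\<^bsub>R\<^esub> t)),
      smult = (\<lambda>a C. \<Union>(b, t)\<in>C. frac R f (a \<otimes>\<^bsub>R\<^esub> b) t)\<rparr>"

text \<open>For \<open>\<phi> : A \<rightarrow> B\<close> such that \<open>\<phi> f\<close> divides \<open>g\<close>, the map \<open>A[1/f] \<rightarrow> B[1/g]\<close>,
  \<open>a/s \<mapsto> \<phi>(a) \<phi>(s)\<^sup>-\<^sup>1\<close>. Here \<open>\<phi> s\<close> is a unit of \<open>B[1/g]\<close>, and the value does not depend on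
  the representative \<open>(a, s)\<close>.\<close>

definition localization_map ::
    "('a \<Rightarrow> 'b) \<Rightarrow> ('b, 's) ring_scheme \<Rightarrow> 'b \<Rightarrow> ('a \<times> 'a) set \<Rightarrow> ('b \<times> 'b) set" where
  "localization_map \<phi> B g C =
     the_elem ((\<lambda>(a, s). frac B g (\<phi> a) \<one>\<^bsub>B\<^esub> \<otimes>\<^bsub>localization B g\<^esub>
                          inv\<^bsub>localization B g\<^esub> (frac B g (\<phi> s) \<one>\<^bsub>B\<^esub>)) ` C)"

text \<open>The ring fields \<open>mult\<close> and \<open>one\<close> of the record are irrelevant here: this is only a module.\<close>

definition MO :: "('a, 'r) ring_scheme \<Rightarrow> 'a \<Rightarrow> ('a, ('a \<times> 'a) set) module" where
  "MO A f = (localization A f)\<lparr>carrier := {frac A f a f | a. a \<in> radical A (PIdl\<^bsub>A\<^esub> f)}\<rparr>"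

end

theory Submission
  imports Defs "HOL-Algebra.RingHom"
begin

text \<open>Faithful flatness gives two facts. If \<open>K \<subseteq> K' \<subseteq> N\<close> are submodules and every \<open>x \<otimes> k\<close> with
  \<open>k \<in> K'\<close> lies in the image of \<open>B \<otimes> K\<close> in \<open>B \<otimes> N\<close>, then \<open>K = K'\<close>. For \<open>N = A\<close>, \<open>K = 0\<close>, \<open>K' = ker \<phi>\<close>
  this is injectivity of \<open>\<phi>\<close>, since \<open>x \<otimes> k = \<phi>(k) x \<otimes> 1 = 0\<close>; for \<open>N = B\<close>, \<open>K = \<phi>(A)\<close>,
  \<open>K' = {b. b \<otimes> 1 = 1 \<otimes> b}\<close> it says that \<open>\<phi>(A)\<close> is the equalizer of \<open>b \<mapsto> b \<otimes> 1\<close> and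
  \<open>b \<mapsto> 1 \<otimes> b\<close>, since \<open>x \<otimes> k = (x \<otimes> 1)(1 \<otimes> k) = xk \<otimes> 1\<close>. And injective endomorphisms stay injective after
  tensoring with \<open>B\<close>, so \<open>f\<close> stays a nonzero divisor in \<open>B\<close> and \<open>B \<otimes> B\<close>.

  An element of the kernel of the last map is \<open>\<phi>(a)/f\<close> with \<open>\<phi>(a)\<^sup>n = c \<phi>(f)\<close>. Comparing the two images in
  \<open>B \<otimes> B\<close> and cancelling \<open>f\<close> gives \<open>c \<otimes> 1 = 1 \<otimes> c\<close>, so \<open>c\<close> comes from \<open>A\<close> and \<open>a\<close> lies in the
  radical of \<open>(f)\<close>.\<close>

section \<open>Tensor products\<close>

lemma linear_mapsI:
  assumes "\<And>x. x \<in> carrier M \<Longrightarrow> u x \<in> carrier N"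
    and "\<And>x y. \<lbrakk>x \<in> carrier M; y \<in> carrier M\<rbrakk> \<Longrightarrow> u (x \<oplus>\<^bsub>M\<^esub> y) = u x \<oplus>\<^bsub>N\<^esub> u y"
    and "\<And>a x. \<lbrakk>a \<in> carrier R; x \<in> carrier M\<rbrakk> \<Longrightarrow> u (a \<odot>\<^bsub>M\<^esub> x) = a \<odot>\<^bsub>N\<^esub> u x"
  shows "u \<in> linear_maps R M N"
  using assms by (auto simp: linear_maps_def hom_def)

lemma linear_mapsD:
  assumes "u \<in> linear_maps R M N"
  shows "x \<in> carrier M \<Longrightarrow> u x \<in> carrier N"
    and "\<lbrakk>x \<in> carrier M; y \<in> carrier M\<rbrakk> \<Longrightarrow> u (x \<oplus>\<^bsub>M\<^esub> y) = u x \<oplus>\<^bsub>N\<^esub> u y"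
    and "\<lbrakk>a \<in> carrier R; x \<in> carrier M\<rbrakk> \<Longrightarrow> u (a \<odot>\<^bsub>M\<^esub> x) = a \<odot>\<^bsub>N\<^esub> u x"
  using assms by (auto simp: linear_maps_def hom_def)

lemma linear_maps_id: "(\<lambda>x. x) \<in> linear_maps R M M"
  by (simp add: linear_mapsI)

lemma linear_maps_comp:
  assumes "u \<in> linear_maps R M N" "v \<in> linear_maps R N P"
  shows "(\<lambda>x. v (u x)) \<in> linear_maps R M P"
  by (rule linear_mapsI) (simp_all add: linear_mapsD[OF assms(1)] linear_mapsD[OF assms(2)])

lemma smult_linear:
  assumes "module R M" "a \<in> carrier R"
  shows "(\<lambda>x. a \<odot>\<^bsub>M\<^esub> x) \<in> linear_maps R M M"
proof -
  interpret module R M by fact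
  show ?thesis
    using assms(2)
    by (intro linear_mapsI) (simp_all add: smult_r_distr flip: smult_assoc1, simp add: m_comm)
qed

lemma linear_maps_zero:
  assumes "module R M" "module R N" "u \<in> linear_maps R M N"
  shows "u \<zero>\<^bsub>M\<^esub> = \<zero>\<^bsub>N\<^esub>"
proof -
  interpret M: module R M by fact
  interpret N: module R N by fact
  have "u (\<zero>\<^bsub>R\<^esub> \<odot>\<^bsub>M\<^esub> \<zero>\<^bsub>M\<^esub>) = \<zero>\<^bsub>R\<^esub> \<odot>\<^bsub>N\<^esub> u \<zero>\<^bsub>M\<^esub>"
    using assms(3) by (simp only: linear_mapsD(3) M.zero_closed M.R.zero_closed)
  then show ?thesis
    using linear_mapsD(1)[OF assms(3)] by simp
qed

lemma linear_maps_minus: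
  assumes "module R M" "module R N" "u \<in> linear_maps R M N" "x \<in> carrier M"
  shows "u (\<ominus>\<^bsub>M\<^esub> x) = \<ominus>\<^bsub>N\<^esub> u x"
proof -
  interpret M: module R M by fact
  interpret N: module R N by fact
  have "u (\<ominus>\<^bsub>M\<^esub> x) \<oplus>\<^bsub>N\<^esub> u x = u (\<ominus>\<^bsub>M\<^esub> x \<oplus>\<^bsub>M\<^esub> x)"
    using assms(3,4) by (simp only: linear_mapsD(2) M.a_inv_closed)
  also have "\<dots> = \<zero>\<^bsub>N\<^esub>"
    using assms by (simp add: M.l_neg linear_maps_zero)
  finally show ?thesis
    using assms(4) linear_mapsD(1)[OF assms(3)] by (metis M.a_inv_closed N.minus_equality)
qed

text \<open>The lift of \<open>p \<otimes> q\<close> to free abelian groups. For suitable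
  \<open>p\<close> and \<open>q\<close> it yields scalar multiplication, \<open>tensor_map\<close>
  and multiplication by a pure tensor, so that one lemma, \<open>pair_map_relns\<close>, shows all
  three to be well defined on classes.\<close>

definition pair_map :: "('m \<Rightarrow> 'p) \<Rightarrow> ('n \<Rightarrow> 'q) \<Rightarrow> ('m \<times> 'n \<Rightarrow>\<^sub>0 int) \<Rightarrow> ('p \<times> 'q \<Rightarrow>\<^sub>0 int)" where
  "pair_map p q = frag_extend (\<lambda>(x, y). frag_of (p x, q y))"

lemma pair_map_of [simp]: "pair_map p q (frag_of (x, y)) = frag_of (p x, q y)"
  by (simp add: pair_map_def)

lemma pair_map_diff: "pair_map p q (c - d) = pair_map p q c - pair_map p q d"
  by (simp add: pair_map_def frag_extend_diff)

lemma pair_map_add: "pair_map p q (c + d) = pair_map p q c + pair_map p q d"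
  by (simp add: pair_map_def frag_extend_add)

section \<open>The tensor product as an abelian group\<close>

locale tensor_pair =
  fixes R :: "('a, 'r) ring_scheme" and M :: "('a, 'm) module" and N :: "('a, 'n) module"
  assumes module_M: "module R M" and module_N: "module R N"
begin

sublocale M: module R M by (rule module_M)
sublocale N: module R N by (rule module_N)

abbreviation "frags \<equiv> free_Abelian_group (carrier M \<times> carrier N)"
abbreviation "relns \<equiv> generate frags (tensor_relators R M N)"
abbreviation "T \<equiv> tensor R M N"
abbreviation "cls \<equiv> tensor_class R M N"
abbreviation "pure \<equiv> pure_tensor R M N"

sublocale frags: comm_group frags
  by (rule abelian_free_Abelian_group)

lemma keys_subset_diff:
  assumes "Poly_Mapping.keys c \<subseteq> S" "Poly_Mapping.keys d \<subseteq> S"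
  shows "Poly_Mapping.keys (c - d) \<subseteq> S"
  using assms keys_diff[of c d] by blast

lemma relators_closed: "tensor_relators R M N \<subseteq> carrier frags"
proof
  fix c assume "c \<in> tensor_relators R M N"
  then show "c \<in> carrier frags"
    unfolding tensor_relators_def carrier_free_Abelian_group_iff
    by (elim UnE CollectE exE conjE; simp only:; intro keys_subset_diff; simp)
qed

lemma relns_subgroup: "subgroup relns frags"
  by (rule frags.generate_is_subgroup[OF relators_closed])

sublocale relns: normal relns frags
  by (rule frags.subgroup_imp_normal[OF relns_subgroup])

lemma relns_keys: "c \<in> relns \<Longrightarrow> Poly_Mapping.keys c \<subseteq> carrier M \<times> carrier N"
  using subsetD[OF relns.subset] by (simp only: carrier_free_Abelian_group_iff)

lemma relns_0: "0 \<in> relns"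
  using relns.one_closed by simp

lemma relns_add: "\<lbrakk>c \<in> relns; d \<in> relns\<rbrakk> \<Longrightarrow> c + d \<in> relns"
  using relns.m_closed by simp

lemma relns_minus: "c \<in> relns \<Longrightarrow> - c \<in> relns"
  using relns.m_inv_closed by (simp add: relns_keys)

lemma relns_diff: "\<lbrakk>c \<in> relns; d \<in> relns\<rbrakk> \<Longrightarrow> c - d \<in> relns"
  using relns_add[OF _ relns_minus] by simp

text \<open>Closure under differences covers both inverses and sums, since
  \<open>- h = 0 - h\<close> and \<open>h1 + h2 = h1 - (0 - h2)\<close>. Maps given by
  \<open>frag_extend\<close> respect differences, which makes this form convenient.\<close>

lemma relns_induct [consumes 1, case_names zero relator diff]:
  assumes "c \<in> relns" "P 0" "\<And>c. c \<in> tensor_relators R M N \<Longrightarrow> P c"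
    and diff: "\<And>c d. \<lbrakk>P c; P d\<rbrakk> \<Longrightarrow> P (c - d)"
  shows "P c"
  using assms(1)
proof induction
  case (inv h)
  with relators_closed diff[OF assms(2)] assms(3)[OF inv] show ?case by (auto simp: subset_eq)
next
  case (eng h1 h2)
  then have "P (h1 - (0 - h2))" using diff assms(2) by blast
  then show ?case by simp
qed (use assms in auto)

lemma cls_eq: "cls c = {d + c | d. d \<in> relns}"
  by (auto simp: tensor_class_def r_coset_def Let_def)

lemma cls_self: "c \<in> cls c"
  unfolding cls_eq using relns_0 by force

lemma cls_memD: "d \<in> cls c \<Longrightarrow> d - c \<in> relns"
  by (auto simp: cls_eq)

lemma cls_eqI: "c - d \<in> relns \<Longrightarrow> cls c = cls d"
proof -
  have *: "cls c \<subseteq> cls d" if "c - d \<in> relns" for c d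
  proof
    fix e assume "e \<in> cls c"
    then obtain k where "k \<in> relns" "e = k + c" by (auto simp: cls_eq)
    moreover from this have "e = (k + (c - d)) + d" by (simp add: algebra_simps)
    moreover have "k + (c - d) \<in> relns"
      using relns_add[OF \<open>k \<in> relns\<close> that] .
    ultimately    show "e \<in> cls d" unfolding cls_eq by blast
  qed
  assume "c - d \<in> relns"
  then show ?thesis
    using *[of c d] *[of d c] relns_minus[of "c - d"] by simp
qed

lemma carrier_tensor: "carrier T = {cls c | c. Poly_Mapping.keys c \<subseteq> carrier M \<times> carrier N}"
  by (auto simp: tensor_def Let_def tensor_class_def FactGroup_def RCOSETS_def)

lemma cls_closed: "Poly_Mapping.keys c \<subseteq> carrier M \<times> carrier N \<Longrightarrow> cls c \<in> carrier T"
  by (auto simp: carrier_tensor)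

lemma pure_closed [simp]: "\<lbrakk>x \<in> carrier M; y \<in> carrier N\<rbrakk> \<Longrightarrow> pure x y \<in> carrier T"
  by (simp add: pure_tensor_def cls_closed)

lemma add_monoid_tensor:
  "carrier (add_monoid T) = carrier (frags Mod relns)"
  "mult (add_monoid T) = mult (frags Mod relns)"
  "one (add_monoid T) = one (frags Mod relns)"
  by (simp_all add: tensor_def Let_def)

text \<open>The additive group of the record \<open>T\<close> is not literally the quotient group,
  so the group laws of \<open>frags Mod relns\<close> are carried over field by field.\<close>

lemma comm_group_add_tensor: "comm_group (add_monoid T)"
proof -
  interpret Q: group "frags Mod relns" by (rule relns.factorgroup_is_group)
  have "comm_group (frags Mod relns)"
    by (rule comm_group.abelian_FactGroup[OF frags.comm_group_axioms relns_subgroup])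
  then interpret Q: comm_group "frags Mod relns" .
  show ?thesis
  proof (rule comm_groupI)
    fix x assume "x \<in> carrier (add_monoid T)"
    then show "\<exists>y\<in>carrier (add_monoid T). y \<otimes>\<^bsub>add_monoid T\<^esub> x = \<one>\<^bsub>add_monoid T\<^esub>"
      unfolding add_monoid_tensor using Q.l_inv_ex by blast
  qed (unfold add_monoid_tensor, (erule (2) Q.m_assoc | erule (1) Q.m_closed Q.m_comm | erule Q.l_one | rule Q.one_closed)+)
qed

sublocale T: abelian_group T
  by (rule abelian_group.intro[OF abelian_monoid.intro abelian_group_axioms.intro])
    (use comm_group_add_tensor in \<open>auto dest: comm_group.axioms\<close>)

lemma cls_add:
  assumes "Poly_Mapping.keys c \<subseteq> carrier M \<times> carrier N" "Poly_Mapping.keys d \<subseteq> carrier M \<times> carrier N"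
  shows "cls c \<oplus>\<^bsub>T\<^esub> cls d = cls (c + d)"
  using relns.rcos_sum[of c d] assms by (simp add: tensor_def tensor_class_def Let_def FactGroup_def)

lemma cls_0: "cls 0 = \<zero>\<^bsub>T\<^esub>"
  using frags.coset_mult_one[OF relns.subset] by (simp add: tensor_def tensor_class_def Let_def FactGroup_def)

lemma cls_diff:
  assumes "Poly_Mapping.keys c \<subseteq> carrier M \<times> carrier N" "Poly_Mapping.keys d \<subseteq> carrier M \<times> carrier N"
  shows "cls c \<ominus>\<^bsub>T\<^esub> cls d = cls (c - d)"
proof -
  have "cls (c - d) \<oplus>\<^bsub>T\<^esub> cls d = cls c"
    using assms by (simp add: cls_add keys_subset_diff)
  then show ?thesis
    using assms by (metis T.add.inv_solve_right a_minus_def cls_closed keys_subset_diff)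
qed

lemma pure_add_left:
  assumes "x \<in> carrier M" "x' \<in> carrier M" "y \<in> carrier N"
  shows "pure (x \<oplus>\<^bsub>M\<^esub> x') y = pure x y \<oplus>\<^bsub>T\<^esub> pure x' y"
proof -
  have "frag_of (x \<oplus>\<^bsub>M\<^esub> x', y) - (frag_of (x, y) + frag_of (x', y)) \<in> relns"
    unfolding diff_diff_add[symmetric]
    by (rule generate.incl) (use assms in \<open>auto simp: tensor_relators_def\<close>)
  then show ?thesis
    using assms by (simp add: pure_tensor_def cls_add cls_eqI)
qed

lemma pure_add_right:
  assumes "x \<in> carrier M" "y \<in> carrier N" "y' \<in> carrier N"
  shows "pure x (y \<oplus>\<^bsub>N\<^esub> y') = pure x y \<oplus>\<^bsub>T\<^esub> pure x y'"
proof -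
  have "frag_of (x, y \<oplus>\<^bsub>N\<^esub> y') - (frag_of (x, y) + frag_of (x, y')) \<in> relns"
    unfolding diff_diff_add[symmetric]
    by (rule generate.incl) (use assms in \<open>auto simp: tensor_relators_def\<close>)
  then show ?thesis
    using assms by (simp add: pure_tensor_def cls_add cls_eqI)
qed

lemma pure_smult:
  assumes "a \<in> carrier R" "x \<in> carrier M" "y \<in> carrier N"
  shows "pure (a \<odot>\<^bsub>M\<^esub> x) y = pure x (a \<odot>\<^bsub>N\<^esub> y)"
  unfolding pure_tensor_def
  by (rule cls_eqI, rule generate.incl) (use assms in \<open>auto simp: tensor_relators_def\<close>)

lemma pure_zero_left: "y \<in> carrier N \<Longrightarrow> pure \<zero>\<^bsub>M\<^esub> y = \<zero>\<^bsub>T\<^esub>"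
  using pure_add_left[of "\<zero>\<^bsub>M\<^esub>" "\<zero>\<^bsub>M\<^esub>" y] by simp

lemma pure_zero_right: "x \<in> carrier M \<Longrightarrow> pure x \<zero>\<^bsub>N\<^esub> = \<zero>\<^bsub>T\<^esub>"
  using pure_add_right[of x "\<zero>\<^bsub>N\<^esub>" "\<zero>\<^bsub>N\<^esub>"] by simp

lemma pure_minus_left:
  assumes "x \<in> carrier M" "y \<in> carrier N"
  shows "\<ominus>\<^bsub>T\<^esub> pure x y = pure (\<ominus>\<^bsub>M\<^esub> x) y"
  using assms pure_add_left[of "\<ominus>\<^bsub>M\<^esub> x" x y] T.minus_equality
  by (simp add: M.l_neg pure_zero_left)

text \<open>No case for inverses arises, because the negative of a pure tensor is again pure by
  \<open>pure_minus_left\<close>.\<close>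

lemma tensor_induct [consumes 1, case_names pure add]:
  assumes "C \<in> carrier T"
    and pure: "\<And>x y. \<lbrakk>x \<in> carrier M; y \<in> carrier N\<rbrakk> \<Longrightarrow> P (pure x y)"
    and add: "\<And>C D. \<lbrakk>C \<in> carrier T; D \<in> carrier T; P C; P D\<rbrakk> \<Longrightarrow> P (C \<oplus>\<^bsub>T\<^esub> D)"
  shows "P C"
proof -
  obtain c where c: "C = cls c" "Poly_Mapping.keys c \<subseteq> carrier M \<times> carrier N"
    using assms(1) by (auto simp: carrier_tensor)
  \<comment> \<open>\<open>frag_induction\<close> proceeds by differences, so \<open>P\<close> is
    carried for a class together with its negative; then only sums have to be formed.\<close>
  let ?Q = "\<lambda>c. Poly_Mapping.keys c \<subseteq> carrier M \<times> carrier N \<and> P (cls c) \<and> P (\<ominus>\<^bsub>T\<^esub> cls c)"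
  have "?Q c"
    using c(2)
  proof (induction c rule: frag_induction)
    case zero
    \<comment> \<open>The zero class is the pure tensor with both entries zero, so it needs no case
      of its own.\<close>
    have minus_0: "\<ominus>\<^bsub>T\<^esub> \<zero>\<^bsub>T\<^esub> = \<zero>\<^bsub>T\<^esub>"
      by (rule T.minus_equality) simp_all
    then show ?case
      using pure[of "\<zero>\<^bsub>M\<^esub>" "\<zero>\<^bsub>N\<^esub>"] by (simp add: pure_zero_left cls_0 minus_0)
  next
    case (one z)
    then show ?case
      using pure[of "fst z" "snd z"] pure[of "\<ominus>\<^bsub>M\<^esub> fst z" "snd z"]
      by (auto simp: pure_minus_left[symmetric]) (simp_all add: pure_tensor_def)
  next
    case (diff c d)
    have mem: "cls c \<in> carrier T" "cls d \<in> carrier T"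
      using diff by (simp_all add: cls_closed)
    have "cls (c - d) = cls c \<oplus>\<^bsub>T\<^esub> \<ominus>\<^bsub>T\<^esub> cls d"
      using diff by (simp add: cls_diff[symmetric] a_minus_def)
    moreover have "\<ominus>\<^bsub>T\<^esub> cls (c - d) = \<ominus>\<^bsub>T\<^esub> cls c \<oplus>\<^bsub>T\<^esub> cls d"
      using mem calculation by (simp add: T.minus_add)
    ultimately show ?case
      using diff mem by (simp add: add keys_subset_diff)
  qed
  then show ?thesis using c by simp
qed

end

text \<open>Each of the three kinds of bilinearity relator is sent to a relator of the same kind: by
  additivity of \<open>p\<close>, by additivity of \<open>q\<close>, and by compatibility of both
  with scalars.\<close>

lemma pair_map_relns:
  assumes "tensor_pair R M N" "tensor_pair R M' N'"
    and p: "p \<in> linear_maps R M M'" and q: "q \<in> linear_maps R N N'"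
  shows "Poly_Mapping.keys c \<subseteq> carrier M \<times> carrier N \<Longrightarrow>
      Poly_Mapping.keys (pair_map p q c) \<subseteq> carrier M' \<times> carrier N'" (is "?keys c \<Longrightarrow> ?keys' c")
    and "c \<in> tensor_pair.relns R M N \<Longrightarrow> pair_map p q c \<in> tensor_pair.relns R M' N'"
proof -
  interpret S: tensor_pair R M N by fact
  interpret T: tensor_pair R M' N' by fact
  note pq = linear_mapsD[OF p] linear_mapsD[OF q]
  show "?keys' c" if "?keys c"
    using that
  proof (induction c rule: frag_induction)
    case (diff a b)
    then show ?case unfolding pair_map_diff by (rule T.keys_subset_diff)
  qed (use pq in \<open>auto simp: pair_map_def\<close>)
  show "pair_map p q c \<in> T.relns" if "c \<in> S.relns"
    using that
  proof (induction rule: S.relns_induct)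
    case (relator c)
    then have "pair_map p q c \<in> tensor_relators R M' N'"
      unfolding tensor_relators_def
      by (elim UnE CollectE exE conjE; simp add: pair_map_diff pq)
        (use pq in blast)+
    then show ?case by (rule generate.incl)
  next
    case (diff c d)
    then show ?case by (simp add: pair_map_diff T.relns_diff)
  qed (use T.relns_0 in \<open>simp_all add: pair_map_def\<close>)
qed

section \<open>The module structure of the tensor product\<close>

context tensor_pair
begin

text \<open>Operations on classes are unions over representatives; this collapses such a union once
  independence of the representative is known.\<close>

lemma UN_cls:
  assumes "\<And>d. d - c \<in> relns \<Longrightarrow> G d = G c"
  shows "(\<Union>d\<in>cls c. G d) = G c"
  using assms cls_memD cls_self by blast

lemma pure_eq_zeroD:
  assumes "pure x y = \<zero>\<^bsub>T\<^esub>"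
  shows "frag_of (x, y) \<in> relns"
  using cls_memD[of "frag_of (x, y)" 0] cls_self[of "frag_of (x, y)"] assms
  by (simp add: pure_tensor_def cls_0)

lemma smult_cls:
  assumes "a \<in> carrier R"
  shows "a \<odot>\<^bsub>T\<^esub> cls c = cls (pair_map (\<lambda>x. a \<odot>\<^bsub>M\<^esub> x) (\<lambda>y. y) c)"
proof -
  have "a \<odot>\<^bsub>T\<^esub> cls c = (\<Union>d\<in>cls c. cls (pair_map (\<lambda>x. a \<odot>\<^bsub>M\<^esub> x) (\<lambda>y. y) d))"
    by (simp add: tensor_def Let_def pair_map_def)
  also have "\<dots> = cls (pair_map (\<lambda>x. a \<odot>\<^bsub>M\<^esub> x) (\<lambda>y. y) c)"
    by (intro UN_cls cls_eqI)
      (simp flip: pair_map_diff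
        add: pair_map_relns(2)[OF tensor_pair_axioms tensor_pair_axioms smult_linear[OF module_M assms] linear_maps_id])
  finally show ?thesis .
qed

lemma smult_pure: "a \<in> carrier R \<Longrightarrow> a \<odot>\<^bsub>T\<^esub> pure x y = pure (a \<odot>\<^bsub>M\<^esub> x) y"
  by (simp add: pure_tensor_def smult_cls)

lemma smult_tensor_closed:
  assumes "a \<in> carrier R" "C \<in> carrier T"
  shows "a \<odot>\<^bsub>T\<^esub> C \<in> carrier T"
proof -
  obtain c where "C = cls c" "Poly_Mapping.keys c \<subseteq> carrier M \<times> carrier N"
    using assms(2) by (auto simp: carrier_tensor)
  then show ?thesis
    using pair_map_relns(1)[OF tensor_pair_axioms tensor_pair_axioms smult_linear[OF module_M assms(1)] linear_maps_id]
    by (simp add: smult_cls[OF assms(1)] cls_closed)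
qed

lemma smult_tensor_add:
  assumes "a \<in> carrier R" "C \<in> carrier T" "D \<in> carrier T"
  shows "a \<odot>\<^bsub>T\<^esub> (C \<oplus>\<^bsub>T\<^esub> D) = a \<odot>\<^bsub>T\<^esub> C \<oplus>\<^bsub>T\<^esub> a \<odot>\<^bsub>T\<^esub> D"
proof -
  note keys = pair_map_relns(1)[OF tensor_pair_axioms tensor_pair_axioms smult_linear[OF module_M assms(1)] linear_maps_id]
  show ?thesis
    using assms(2,3) unfolding carrier_tensor
    by (auto simp: smult_cls[OF assms(1)] cls_add keys pair_map_add)
qed

text \<open>Scalar multiplication is already additive in the class, so the remaining laws need
  checking only on pure tensors, where they come from the laws of \<open>M\<close>.\<close>

lemma module_tensor: "module R T"
proof (rule moduleI)
  fix a b C assume a: "a \<in> carrier R" and b: "b \<in> carrier R" and C: "C \<in> carrier T"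
  show "(a \<oplus>\<^bsub>R\<^esub> b) \<odot>\<^bsub>T\<^esub> C = a \<odot>\<^bsub>T\<^esub> C \<oplus>\<^bsub>T\<^esub> b \<odot>\<^bsub>T\<^esub> C"
    using C
    by (induction rule: tensor_induct)
      (simp_all add: a b smult_pure M.smult_l_distr pure_add_left smult_tensor_add smult_tensor_closed T.add.m_ac)
  show "(a \<otimes>\<^bsub>R\<^esub> b) \<odot>\<^bsub>T\<^esub> C = a \<odot>\<^bsub>T\<^esub> (b \<odot>\<^bsub>T\<^esub> C)"
    using C
    by (induction rule: tensor_induct)
      (simp_all add: a b smult_pure M.smult_assoc1 smult_tensor_add smult_tensor_closed)
next
  fix C assume "C \<in> carrier T"
  then show "\<one>\<^bsub>R\<^esub> \<odot>\<^bsub>T\<^esub> C = C"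
    by (induction rule: tensor_induct) (simp_all add: smult_pure smult_tensor_add)
qed (simp_all add: M.R.cring_axioms T.abelian_group_axioms smult_tensor_closed smult_tensor_add)

end

section \<open>Functoriality in the second factor\<close>

lemma tensor_map_cls:
  assumes "tensor_pair R M N" "tensor_pair R M N'" "u \<in> linear_maps R N N'"
  shows "tensor_map R M N' u (tensor_class R M N c) = tensor_class R M N' (pair_map (\<lambda>x. x) u c)"
proof -
  interpret S: tensor_pair R M N by fact
  interpret S': tensor_pair R M N' by fact
  have "tensor_map R M N' u (tensor_class R M N c) = (\<Union>d\<in>S.cls c. S'.cls (pair_map (\<lambda>x. x) u d))"
    by (simp add: tensor_map_def pair_map_def)
  also have "\<dots> = S'.cls (pair_map (\<lambda>x. x) u c)"
    by (intro S.UN_cls S'.cls_eqI)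
      (simp flip: pair_map_diff add: pair_map_relns(2)[OF assms(1,2) linear_maps_id assms(3)])
  finally show ?thesis .
qed

lemma tensor_map_pure:
  assumes "tensor_pair R M N" "tensor_pair R M N'" "u \<in> linear_maps R N N'"
  shows "tensor_map R M N' u (pure_tensor R M N x y) = pure_tensor R M N' x (u y)"
  using tensor_map_cls[OF assms] by (simp add: pure_tensor_def)

lemma tensor_map_linear:
  assumes "tensor_pair R M N" "tensor_pair R M N'" "u \<in> linear_maps R N N'"
  shows "tensor_map R M N' u \<in> linear_maps R (tensor R M N) (tensor R M N')"
proof -
  interpret S: tensor_pair R M N by fact
  interpret S': tensor_pair R M N' by fact
  note keys = pair_map_relns(1)[OF assms(1,2) linear_maps_id assms(3)]
  have closed: "tensor_map R M N' u C \<in> carrier S'.T" if "C \<in> carrier S.T" for C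
    using that unfolding S.carrier_tensor
    by (auto simp: tensor_map_cls[OF assms] intro!: S'.cls_closed keys)
  have add: "tensor_map R M N' u (C \<oplus>\<^bsub>S.T\<^esub> D) = tensor_map R M N' u C \<oplus>\<^bsub>S'.T\<^esub> tensor_map R M N' u D"
    if "C \<in> carrier S.T" "D \<in> carrier S.T" for C D
    using that unfolding S.carrier_tensor
    by (auto simp: tensor_map_cls[OF assms] S.cls_add S'.cls_add keys pair_map_add)
  show ?thesis
  proof (rule linear_mapsI)
    fix a C assume a: "a \<in> carrier R" and C: "C \<in> carrier S.T"
    show "tensor_map R M N' u (a \<odot>\<^bsub>S.T\<^esub> C) = a \<odot>\<^bsub>S'.T\<^esub> tensor_map R M N' u C"
      using C
      by (induction rule: S.tensor_induct)
        (simp_all add: a S.smult_pure S'.smult_pure tensor_map_pure[OF assms] S.smult_tensor_add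
          S'.smult_tensor_add add closed S.smult_tensor_closed)
  qed (use closed add in auto)
qed

text \<open>The third map \<open>w\<close> only has to agree with the composite on
  \<open>carrier N\<close>. This allows \<open>inv_into\<close> as an inverse and inclusions between
  records that differ in their carrier.\<close>

lemma tensor_map_comp:
  assumes "tensor_pair R M N" "tensor_pair R M N'" "tensor_pair R M N''"
    and "u \<in> linear_maps R N N'" "v \<in> linear_maps R N' N''" "w \<in> linear_maps R N N''"
    and "\<And>y. y \<in> carrier N \<Longrightarrow> v (u y) = w y" "C \<in> carrier (tensor R M N)"
  shows "tensor_map R M N'' v (tensor_map R M N' u C) = tensor_map R M N'' w C"
proof -
  interpret S: tensor_pair R M N by fact
  note lin = tensor_map_linear[OF assms(1,2,4)] tensor_map_linear[OF assms(2,3,5)]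
    tensor_map_linear[OF assms(1,3,6)]
  show ?thesis
    using assms(8)
    by (induction rule: S.tensor_induct)
      (simp_all add: tensor_map_pure[OF assms(1,2,4)] tensor_map_pure[OF assms(2,3,5)]
        tensor_map_pure[OF assms(1,3,6)] assms(7) lin[THEN linear_mapsD(2)] lin[THEN linear_mapsD(1)])
qed

lemma tensor_map_id:
  assumes "tensor_pair R M N" "C \<in> carrier (tensor R M N)"
  shows "tensor_map R M N (\<lambda>x. x) C = C"
proof -
  interpret S: tensor_pair R M N by fact
  show ?thesis
    using assms(2)
    by (induction rule: S.tensor_induct)
      (simp_all add: tensor_map_pure[OF assms(1,1) linear_maps_id] linear_mapsD(2)[OF tensor_map_linear[OF assms(1,1) linear_maps_id]])
qed

subsection \<open>The tensor product of two algebras\<close>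

lemma algebra_of_simps [simp]:
  "carrier (algebra_of \<phi> B) = carrier B"
  "monoid.mult (algebra_of \<phi> B) = monoid.mult B"
  "\<one>\<^bsub>algebra_of \<phi> B\<^esub> = \<one>\<^bsub>B\<^esub>"
  "\<zero>\<^bsub>algebra_of \<phi> B\<^esub> = \<zero>\<^bsub>B\<^esub>"
  "add (algebra_of \<phi> B) = add B"
  "smult (algebra_of \<phi> B) = (\<lambda>a b. \<phi> a \<otimes>\<^bsub>B\<^esub> b)"
  by (simp_all add: algebra_of_def)

lemma (in cring) module_algebra_of:
  assumes "cring A" "\<phi> \<in> ring_hom A R"
  shows "module A (algebra_of \<phi> R)"
proof (rule moduleI)
  show "abelian_group (algebra_of \<phi> R)"
    by (rule abelian_groupI) (auto simp: a_ac intro: add.l_inv_ex)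
qed (use assms in \<open>simp_all add: ring_hom_memE l_distr r_distr m_assoc ring_hom_closed\<close>)

lemma module_self:
  assumes "cring R"
  shows "module R (algebra_of (\<lambda>x. x) R)"
  by (rule cring.module_algebra_of[OF assms assms]) (simp add: ring_hom_def)

text \<open>One half of the isomorphism of \<open>M \<otimes> R\<close> with \<open>M\<close>. The
  action \<open>(x, a) \<mapsto> a \<odot> x\<close> extends to the free abelian group and kills the
  bilinearity relators, so it vanishes on \<open>(x, 1)\<close> when this pair represents zero; its
  value there is \<open>x\<close>.\<close>

lemma pure_one_eq_zeroD:
  assumes "module R M" "x \<in> carrier M"
    and eq: "pure_tensor R M (algebra_of (\<lambda>x. x) R) x \<one>\<^bsub>R\<^esub> = \<zero>\<^bsub>tensor R M (algebra_of (\<lambda>x. x) R)\<^esub>"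
  shows "x = \<zero>\<^bsub>M\<^esub>"
proof -
  define N where "N = algebra_of (\<lambda>x. x) R"
  interpret M: module R M by fact
  interpret tensor_pair R M N
    unfolding N_def by (rule tensor_pair.intro[OF assms(1) module_self[OF M.R.cring_axioms]])
  note N = N_def
  have "(\<lambda>(x, a). a \<odot>\<^bsub>M\<^esub> x) ` (carrier M \<times> carrier N) \<subseteq> carrier (add_monoid M)"
    by (auto simp: N)
  then obtain h where h: "h \<in> hom frags (add_monoid M)"
    and h_of: "\<And>z. z \<in> carrier M \<times> carrier N \<Longrightarrow> h (frag_of z) = (\<lambda>(x, a). a \<odot>\<^bsub>M\<^esub> x) z"
    using comm_group.free_Abelian_group_universal[OF M.M.a_comm_group] by metis
  interpret h: group_hom frags "add_monoid M" h
    by (intro group_hom.intro group_hom_axioms.intro h M.M.a_group frags.group_axioms)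
  have h_diff: "h (c - d) = h c \<ominus>\<^bsub>M\<^esub> h d"
    if "Poly_Mapping.keys c \<subseteq> carrier M \<times> carrier N" "Poly_Mapping.keys d \<subseteq> carrier M \<times> carrier N" for c d
    using h.hom_mult[of c "- d"] h.hom_inv[of d] that by (simp add: a_minus_def a_inv_def)
  \<comment> \<open>The additivity relators are mapped to terms of this shape; \<open>swap\<close>
    deals with the scalar relators.\<close>
  have cancel: "p \<oplus>\<^bsub>M\<^esub> q \<ominus>\<^bsub>M\<^esub> p \<ominus>\<^bsub>M\<^esub> q = \<zero>\<^bsub>M\<^esub>" if "p \<in> carrier M" "q \<in> carrier M" for p q
    using that by (simp add: M.M.minus_eq M.M.a_assoc M.M.r_neg flip: M.M.minus_add)
      (simp add: M.M.r_neg flip: M.M.a_assoc)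
  have swap: "b \<odot>\<^bsub>M\<^esub> (a \<odot>\<^bsub>M\<^esub> x) = a \<odot>\<^bsub>M\<^esub> (b \<odot>\<^bsub>M\<^esub> x)"
    if "a \<in> carrier R" "b \<in> carrier R" "x \<in> carrier M" for a b x
    using that by (simp add: M.R.m_comm flip: M.smult_assoc1)
  have "tensor_relators R M N \<subseteq> kernel frags (add_monoid M) h"
  proof
    fix c assume c: "c \<in> tensor_relators R M N"
    then have "h c = \<zero>\<^bsub>M\<^esub>"
      unfolding tensor_relators_def
      by (elim UnE CollectE exE conjE)
        (simp_all add: h_diff keys_subset_diff h_of N M.smult_r_distr M.smult_l_distr cancel,
          simp add: M.smult_assoc1 swap M.M.minus_eq M.M.r_neg)
    then show "c \<in> kernel frags (add_monoid M) h"
      using subsetD[OF relators_closed c] by (simp add: kernel_def)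
  qed
  then have "relns \<subseteq> kernel frags (add_monoid M) h"
    by (rule frags.generate_subgroup_incl[OF _ h.subgroup_kernel])
  then have "h (frag_of (x, \<one>\<^bsub>R\<^esub>)) = \<zero>\<^bsub>M\<^esub>"
    using pure_eq_zeroD[OF eq[folded N]] by (auto simp: kernel_def)
  then show ?thesis
    using assms(2) by (simp add: h_of N)
qed

section \<open>Multiplication on the tensor product of two algebras\<close>

locale tensor_algebra = A: cring A + B: cring B + C: cring C
  for A :: "('a, 'r) ring_scheme" and B :: "('b, 's) ring_scheme" and C :: "('c, 't) ring_scheme" +
  fixes \<phi> :: "'a \<Rightarrow> 'b" and \<psi> :: "'a \<Rightarrow> 'c"
  assumes \<phi>: "\<phi> \<in> ring_hom A B" and \<psi>: "\<psi> \<in> ring_hom A C"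
begin

sublocale tensor_pair A "algebra_of \<phi> B" "algebra_of \<psi> C"
  by (intro tensor_pair.intro B.module_algebra_of C.module_algebra_of A.cring_axioms \<phi> \<psi>)

text \<open>Written so that multiplication by a single generator is a \<open>pair_map\<close> of
  left multiplications, to which \<open>pair_map_relns\<close> applies.\<close>

definition mul_frag :: "('b \<times> 'c \<Rightarrow>\<^sub>0 int) \<Rightarrow> ('b \<times> 'c \<Rightarrow>\<^sub>0 int) \<Rightarrow> ('b \<times> 'c \<Rightarrow>\<^sub>0 int)" where
  "mul_frag c d = frag_extend (\<lambda>(x, y). pair_map (\<lambda>x'. x \<otimes>\<^bsub>B\<^esub> x') (\<lambda>y'. y \<otimes>\<^bsub>C\<^esub> y') d) c"

lemma mul_frag_of: "mul_frag (frag_of (x, y)) d = pair_map (\<lambda>x'. x \<otimes>\<^bsub>B\<^esub> x') (\<lambda>y'. y \<otimes>\<^bsub>C\<^esub> y') d"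
  by (simp add: mul_frag_def)

lemma mul_frag_0 [simp]: "mul_frag 0 d = 0" "mul_frag c 0 = 0"
  by (auto simp: mul_frag_def pair_map_def intro: frag_extend_eq_0)

lemma mul_frag_diff_left: "mul_frag (c - c') d = mul_frag c d - mul_frag c' d"
  by (simp add: mul_frag_def frag_extend_diff)

lemma mul_frag_diff_right: "mul_frag c (d - d') = mul_frag c d - mul_frag c d'"
  \<comment> \<open>Distributivity holds for arbitrary formal sums, so the support bound of
    \<open>frag_induction\<close> is taken trivial.\<close>
  using subset_UNIV
proof (induction c rule: frag_induction)
  case (one z)
  then show ?case by (cases z) (simp add: mul_frag_of pair_map_diff)
qed (simp_all add: mul_frag_diff_left)

lemma mul_frag_commute:
  assumes "Poly_Mapping.keys c \<subseteq> carrier B \<times> carrier C" "Poly_Mapping.keys d \<subseteq> carrier B \<times> carrier C"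
  shows "mul_frag c d = mul_frag d c"
  using assms(1)
proof (induction c rule: frag_induction)
  case (one z)
  from assms(2) show ?case
  proof (induction d rule: frag_induction)
    case (one z')
    with \<open>z \<in> _\<close> show ?case by (auto simp: mul_frag_of B.m_comm C.m_comm)
  qed (simp_all add: mul_frag_diff_left mul_frag_diff_right)
qed (simp_all add: mul_frag_diff_left mul_frag_diff_right)

lemma mult_linear:
  "x \<in> carrier B \<Longrightarrow> (\<lambda>x'. x \<otimes>\<^bsub>B\<^esub> x') \<in> linear_maps A (algebra_of \<phi> B) (algebra_of \<phi> B)"
  "y \<in> carrier C \<Longrightarrow> (\<lambda>y'. y \<otimes>\<^bsub>C\<^esub> y') \<in> linear_maps A (algebra_of \<psi> C) (algebra_of \<psi> C)"
  by (auto intro!: linear_mapsI simp: B.r_distr C.r_distr B.m_lcomm C.m_lcomm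
      ring_hom_closed[OF \<phi>] ring_hom_closed[OF \<psi>])

lemma mul_frag_keys:
  assumes "Poly_Mapping.keys c \<subseteq> carrier B \<times> carrier C" "Poly_Mapping.keys d \<subseteq> carrier B \<times> carrier C"
  shows "Poly_Mapping.keys (mul_frag c d) \<subseteq> carrier B \<times> carrier C"
  using assms(1)
proof (induction c rule: frag_induction)
  case (one z)
  then show ?case
    using pair_map_relns(1)[OF tensor_pair_axioms tensor_pair_axioms mult_linear, of "fst z" "snd z" d] assms(2)
    by (cases z) (simp add: mul_frag_of)
qed (simp_all add: mul_frag_diff_left keys_subset_diff)

lemma mul_frag_relns:
  assumes "Poly_Mapping.keys c \<subseteq> carrier B \<times> carrier C" "d \<in> relns"
  shows "mul_frag c d \<in> relns"
  using assms(1)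
proof (induction c rule: frag_induction)
  case (one z)
  then show ?case
    using pair_map_relns(2)[OF tensor_pair_axioms tensor_pair_axioms mult_linear, of "fst z" "snd z" d] assms(2)
    by (cases z) (simp add: mul_frag_of)
qed (simp_all only: mul_frag_0 mul_frag_diff_left relns_diff relns_0)

lemma mult_cls:
  assumes c: "Poly_Mapping.keys c \<subseteq> carrier B \<times> carrier C" and d: "Poly_Mapping.keys d \<subseteq> carrier B \<times> carrier C"
  shows "cls c \<otimes>\<^bsub>T\<^esub> cls d = cls (mul_frag c d)"
proof -
  have "cls c \<otimes>\<^bsub>T\<^esub> cls d = (\<Union>c'\<in>cls c. \<Union>d'\<in>cls d. cls (mul_frag c' d'))"
    by (simp add: tensor_def Let_def mul_frag_def pair_map_def)
  also have "\<dots> = (\<Union>d'\<in>cls d. cls (mul_frag c d'))"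
  proof (rule UN_cls)
    fix c' assume c': "c' - c \<in> relns"
    have "Poly_Mapping.keys c' \<subseteq> carrier B \<times> carrier C"
      using keys_add[of "c' - c" c] relns_keys[OF c'] c by auto
    moreover have "cls (mul_frag c' d') = cls (mul_frag c d')" if "d' \<in> cls d" for d'
    proof (rule cls_eqI)
      have d': "Poly_Mapping.keys d' \<subseteq> carrier B \<times> carrier C"
        using keys_add[of "d' - d" d] relns_keys[OF cls_memD[OF that]] d by auto
      \<comment> \<open>Commutativity moves the relation \<open>c' - c\<close> into the right
        factor, where \<open>mul_frag_relns\<close> applies.\<close>
      have "mul_frag c' d' - mul_frag c d' = mul_frag d' (c' - c)"
        using d' relns_keys[OF c'] mul_frag_commute[of d' "c' - c"] by (simp add: mul_frag_diff_left)
      then show "mul_frag c' d' - mul_frag c d' \<in> relns"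
        using mul_frag_relns[OF d' c'] by simp
    qed
    ultimately show "(\<Union>d'\<in>cls d. cls (mul_frag c' d')) = (\<Union>d'\<in>cls d. cls (mul_frag c d'))"
      by auto
  qed
  also have "\<dots> = cls (mul_frag c d)"
    by (intro UN_cls cls_eqI) (simp only: mul_frag_diff_right[symmetric] mul_frag_relns[OF c])
  finally show ?thesis .
qed

lemma mult_pure:
  assumes "x \<in> carrier B" "y \<in> carrier C" "x' \<in> carrier B" "y' \<in> carrier C"
  shows "pure x y \<otimes>\<^bsub>T\<^esub> pure x' y' = pure (x \<otimes>\<^bsub>B\<^esub> x') (y \<otimes>\<^bsub>C\<^esub> y')"
  using assms by (simp add: pure_tensor_def mult_cls mul_frag_of)

lemma tensor_mult_closed: "\<lbrakk>D \<in> carrier T; E \<in> carrier T\<rbrakk> \<Longrightarrow> D \<otimes>\<^bsub>T\<^esub> E \<in> carrier T"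
proof -
  assume "D \<in> carrier T" "E \<in> carrier T"
  then obtain d e where "D = cls d" "E = cls e" "Poly_Mapping.keys d \<subseteq> carrier B \<times> carrier C"
    "Poly_Mapping.keys e \<subseteq> carrier B \<times> carrier C"
    by (auto simp: carrier_tensor)
  then show ?thesis
    by (simp add: mult_cls mul_frag_keys cls_closed)
qed

lemma tensor_mult_commute: "\<lbrakk>D \<in> carrier T; E \<in> carrier T\<rbrakk> \<Longrightarrow> D \<otimes>\<^bsub>T\<^esub> E = E \<otimes>\<^bsub>T\<^esub> D"
  by (auto simp: carrier_tensor mult_cls mul_frag_commute)

lemma tensor_l_distr:
  assumes "D \<in> carrier T" "E \<in> carrier T" "F \<in> carrier T"
  shows "(D \<oplus>\<^bsub>T\<^esub> E) \<otimes>\<^bsub>T\<^esub> F = D \<otimes>\<^bsub>T\<^esub> F \<oplus>\<^bsub>T\<^esub> E \<otimes>\<^bsub>T\<^esub> F"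
proof -
  obtain d e f where cls: "D = cls d" "E = cls e" "F = cls f"
    and keys: "Poly_Mapping.keys d \<subseteq> carrier B \<times> carrier C"
      "Poly_Mapping.keys e \<subseteq> carrier B \<times> carrier C" "Poly_Mapping.keys f \<subseteq> carrier B \<times> carrier C"
    using assms by (auto simp: carrier_tensor)
  have "Poly_Mapping.keys (d + e) \<subseteq> carrier B \<times> carrier C"
    using keys keys_add[of d e] by blast
  moreover have "mul_frag (d + e) f = mul_frag d f + mul_frag e f"
    by (simp add: mul_frag_def frag_extend_add)
  ultimately show ?thesis
    using keys by (simp add: cls cls_add mult_cls mul_frag_keys)
qed

lemma tensor_r_distr:
  assumes "D \<in> carrier T" "E \<in> carrier T" "F \<in> carrier T"
  shows "F \<otimes>\<^bsub>T\<^esub> (D \<oplus>\<^bsub>T\<^esub> E) = F \<otimes>\<^bsub>T\<^esub> D \<oplus>\<^bsub>T\<^esub> F \<otimes>\<^bsub>T\<^esub> E"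
  using assms by (simp add: tensor_l_distr tensor_mult_commute[of F])

lemma one_tensor: "\<one>\<^bsub>T\<^esub> = pure \<one>\<^bsub>B\<^esub> \<one>\<^bsub>C\<^esub>"
  by (simp add: tensor_def Let_def pure_tensor_def)

text \<open>First of three rounds: induction on the first factor while the other two are pure.
  \<open>tensor_cring\<close> then frees the second factor and finally the third.\<close>

lemma tensor_assoc_pure:
  assumes "D \<in> carrier T" "x \<in> carrier B" "y \<in> carrier C" "x' \<in> carrier B" "y' \<in> carrier C"
  shows "D \<otimes>\<^bsub>T\<^esub> pure x y \<otimes>\<^bsub>T\<^esub> pure x' y' = D \<otimes>\<^bsub>T\<^esub> (pure x y \<otimes>\<^bsub>T\<^esub> pure x' y')"
  using assms(1)
  by (induction rule: tensor_induct)
    (use assms(2-) in \<open>simp_all add: mult_pure B.m_assoc C.m_assoc tensor_l_distr tensor_mult_closed\<close>)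

lemma tensor_cring: "cring T"
proof (rule cringI)
  show "comm_monoid T"
  proof (rule comm_monoidI)
    fix D E F assume D: "D \<in> carrier T" and E: "E \<in> carrier T" and F: "F \<in> carrier T"
    have assoc: "D \<otimes>\<^bsub>T\<^esub> E \<otimes>\<^bsub>T\<^esub> pure x y = D \<otimes>\<^bsub>T\<^esub> (E \<otimes>\<^bsub>T\<^esub> pure x y)"
      if "x \<in> carrier B" "y \<in> carrier C" for x y
      using E that
      by (induction rule: tensor_induct)
        (simp_all add: D tensor_assoc_pure tensor_l_distr tensor_r_distr tensor_mult_closed)
    show "D \<otimes>\<^bsub>T\<^esub> E \<otimes>\<^bsub>T\<^esub> F = D \<otimes>\<^bsub>T\<^esub> (E \<otimes>\<^bsub>T\<^esub> F)"
      using F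
      by (induction rule: tensor_induct) (simp_all add: assoc D E tensor_r_distr tensor_mult_closed)
  next
    fix D assume "D \<in> carrier T"
    then show "\<one>\<^bsub>T\<^esub> \<otimes>\<^bsub>T\<^esub> D = D"
      by (induction rule: tensor_induct) (simp_all add: one_tensor mult_pure tensor_r_distr)
  qed (simp_all add: one_tensor tensor_mult_closed tensor_mult_commute)
qed (simp_all add: T.abelian_group_axioms tensor_l_distr)

sublocale Tring: cring T
  by (rule tensor_cring)

lemma tensor_left_hom: "(\<lambda>b. pure b \<one>\<^bsub>C\<^esub>) \<in> ring_hom B T"
  by (rule ring_hom_memI)
    (use pure_add_left in \<open>simp_all add: mult_pure one_tensor\<close>)

lemma tensor_right_hom: "(\<lambda>c. pure \<one>\<^bsub>B\<^esub> c) \<in> ring_hom C T"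
  by (rule ring_hom_memI)
    (use pure_add_right in \<open>simp_all add: mult_pure one_tensor\<close>)

text \<open>The scalar \<open>a\<close> crosses the tensor sign in \<open>1 \<otimes> 1\<close>.
  Later this identifies the two images of \<open>f\<close> and places the image of
  \<open>\<phi>\<close> in the equalizer.\<close>

lemma tensor_base_change:
  assumes "a \<in> carrier A"
  shows "pure (\<phi> a) \<one>\<^bsub>C\<^esub> = pure \<one>\<^bsub>B\<^esub> (\<psi> a)"
  using pure_smult[of a "\<one>\<^bsub>B\<^esub>" "\<one>\<^bsub>C\<^esub>"] assms
  by (simp add: ring_hom_closed[OF \<phi>] ring_hom_closed[OF \<psi>])

end

section \<open>Faithful flatness\<close>

lemma tensor_map_zero:
  assumes "tensor_pair R M N" "tensor_pair R M N'" "u \<in> linear_maps R N N'"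
  shows "tensor_map R M N' u \<zero>\<^bsub>tensor R M N\<^esub> = \<zero>\<^bsub>tensor R M N'\<^esub>"
  by (rule linear_maps_zero[OF assms(1,2)[THEN tensor_pair.module_tensor] tensor_map_linear[OF assms]])

text \<open>The module structure on \<open>p ` carrier N\<close> induced by a map \<open>p\<close> whose fibres are the classes of a
  congruence. It provides both isomorphic copies and quotients of \<open>N\<close> with carriers in a given type.\<close>

definition image_module :: "('n \<Rightarrow> 'u) \<Rightarrow> ('a, 'n) module \<Rightarrow> ('a, 'u) module" where
  "image_module p N =
     \<lparr>carrier = p ` carrier N, monoid.mult = undefined, one = undefined, ring.zero = p \<zero>\<^bsub>N\<^esub>,
      add = (\<lambda>X Y. p (inv_into (carrier N) p X \<oplus>\<^bsub>N\<^esub> inv_into (carrier N) p Y)),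
      smult = (\<lambda>a X. p (a \<odot>\<^bsub>N\<^esub> inv_into (carrier N) p X))\<rparr>"

lemma carrier_image_module [simp]: "carrier (image_module p N) = p ` carrier N"
  by (simp add: image_module_def)

lemma zero_image_module [simp]: "\<zero>\<^bsub>image_module p N\<^esub> = p \<zero>\<^bsub>N\<^esub>"
  by (simp add: image_module_def)

text \<open>\<open>inv_into\<close> returns some representative, which differs from the given one by
  an element of \<open>K\<close>. Because \<open>K\<close> is a submodule, these differences stay in
  \<open>K\<close> under sums and scalar multiples, so \<open>p\<close> is linear; being onto its
  image, it carries the module laws over.\<close>

lemma image_module:
  assumes "module R N" "submodule K R N"
    and p: "\<And>x y. \<lbrakk>x \<in> carrier N; y \<in> carrier N\<rbrakk> \<Longrightarrow> p x = p y \<longleftrightarrow> x \<ominus>\<^bsub>N\<^esub> y \<in> K"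
  shows "module R (image_module p N)" "p \<in> linear_maps R N (image_module p N)"
proof -
  interpret N: module R N by fact
  note K = N.submoduleE[OF assms(2)]
  let ?s = "inv_into (carrier N) p"
  have s: "?s (p x) \<in> carrier N" "p (?s (p x)) = p x" if "x \<in> carrier N" for x
    using that by (auto intro: inv_into_into f_inv_into_f)
  have add: "p x \<oplus>\<^bsub>image_module p N\<^esub> p y = p (x \<oplus>\<^bsub>N\<^esub> y)" if "x \<in> carrier N" "y \<in> carrier N" for x y
  proof -
    have "?s (p x) \<ominus>\<^bsub>N\<^esub> x \<in> K" "?s (p y) \<ominus>\<^bsub>N\<^esub> y \<in> K"
      using p s that by blast+
    then have "(?s (p x) \<ominus>\<^bsub>N\<^esub> x) \<oplus>\<^bsub>N\<^esub> (?s (p y) \<ominus>\<^bsub>N\<^esub> y) \<in> K"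
      by (rule K(5))
    also have "(?s (p x) \<ominus>\<^bsub>N\<^esub> x) \<oplus>\<^bsub>N\<^esub> (?s (p y) \<ominus>\<^bsub>N\<^esub> y) = (?s (p x) \<oplus>\<^bsub>N\<^esub> ?s (p y)) \<ominus>\<^bsub>N\<^esub> (x \<oplus>\<^bsub>N\<^esub> y)"
      using s that by (simp add: a_minus_def N.M.minus_add N.M.a_ac)
    finally show ?thesis
      using p s that by (simp add: image_module_def)
  qed
  have smult: "a \<odot>\<^bsub>image_module p N\<^esub> p x = p (a \<odot>\<^bsub>N\<^esub> x)" if "a \<in> carrier R" "x \<in> carrier N" for a x
  proof -
    have "?s (p x) \<ominus>\<^bsub>N\<^esub> x \<in> K"
      using p s that by blast
    then have "a \<odot>\<^bsub>N\<^esub> (?s (p x) \<ominus>\<^bsub>N\<^esub> x) \<in> K"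
      using K(4) that by blast
    also have "a \<odot>\<^bsub>N\<^esub> (?s (p x) \<ominus>\<^bsub>N\<^esub> x) = a \<odot>\<^bsub>N\<^esub> ?s (p x) \<ominus>\<^bsub>N\<^esub> a \<odot>\<^bsub>N\<^esub> x"
      using s that by (simp add: a_minus_def N.smult_r_distr N.smult_r_minus)
    finally show ?thesis
      using p s that by (simp add: image_module_def)
  qed
  show "p \<in> linear_maps R N (image_module p N)"
    by (rule linear_mapsI) (simp_all add: add smult)
  show "module R (image_module p N)"
  proof (rule moduleI)
    show "abelian_group (image_module p N)"
    proof (rule abelian_groupI)
      fix X assume "X \<in> carrier (image_module p N)"
      then obtain x where "x \<in> carrier N" "X = p x" by auto
      then show "\<exists>Y\<in>carrier (image_module p N). Y \<oplus>\<^bsub>image_module p N\<^esub> X = \<zero>\<^bsub>image_module p N\<^esub>"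
        by (auto simp: add N.M.l_neg intro!: bexI[of _ "\<ominus>\<^bsub>N\<^esub> x"])
    qed (auto simp: add N.M.a_ac)
  qed (auto simp: add smult N.R.cring_axioms N.smult_l_distr N.smult_r_distr N.smult_assoc1)
qed

text \<open>The case of the zero submodule in \<open>image_module\<close>: an injective map
  separates all elements, and the result is a relabelled copy of \<open>N\<close>.\<close>

lemma image_module_inj:
  assumes "module R N" "inj_on p (carrier N)"
  shows "module R (image_module p N)" "p \<in> linear_maps R N (image_module p N)"
    "inv_into (carrier N) p \<in> linear_maps R (image_module p N) N"
proof -
  interpret N: module R N by fact
  have sub: "submodule {\<zero>\<^bsub>N\<^esub>} R N"
    by (rule N.submoduleI) auto
  have "p x = p y \<longleftrightarrow> x \<ominus>\<^bsub>N\<^esub> y \<in> {\<zero>\<^bsub>N\<^esub>}" if "x \<in> carrier N" "y \<in> carrier N" for x y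
    using that inj_onD[OF assms(2), of x y] N.M.minus_equality[of x "\<ominus>\<^bsub>N\<^esub> y"]
    by (auto simp: a_minus_def N.M.r_neg)
  then show "module R (image_module p N)" "p \<in> linear_maps R N (image_module p N)"
    using image_module[OF assms(1) sub] by blast+
  show "inv_into (carrier N) p \<in> linear_maps R (image_module p N) N"
    using assms(2) by (intro linear_mapsI) (auto simp: image_module_def)
qed

text \<open>Supplies the fibre condition of \<open>image_module\<close> when \<open>p\<close> sends
  an element to its coset, which is how the quotient by a submodule is obtained.\<close>

lemma coset_eq_iff_minus_mem:
  assumes "module R N" "submodule K R N"
  shows "x \<in> carrier N \<Longrightarrow> y \<in> carrier N \<Longrightarrow>
    {z \<in> carrier N. z \<ominus>\<^bsub>N\<^esub> x \<in> K} = {z \<in> carrier N. z \<ominus>\<^bsub>N\<^esub> y \<in> K} \<longleftrightarrow> x \<ominus>\<^bsub>N\<^esub> y \<in> K"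
proof -
  interpret N: module R N by fact
  note K = N.submoduleE[OF assms(2)]
  assume x: "x \<in> carrier N" and y: "y \<in> carrier N"
  have trans: "z \<ominus>\<^bsub>N\<^esub> y \<in> K" if "z \<ominus>\<^bsub>N\<^esub> x \<in> K" "x \<ominus>\<^bsub>N\<^esub> y \<in> K" "x \<in> carrier N" "y \<in> carrier N" "z \<in> carrier N" for x y z
  proof -
    have "(z \<ominus>\<^bsub>N\<^esub> x) \<oplus>\<^bsub>N\<^esub> (x \<ominus>\<^bsub>N\<^esub> y) = z \<ominus>\<^bsub>N\<^esub> y"
      using that by (simp add: a_minus_def N.M.a_assoc N.M.r_neg1)
    then show ?thesis using K(5)[OF that(1,2)] by simp
  qed
  have sym: "y \<ominus>\<^bsub>N\<^esub> x \<in> K" if "x \<ominus>\<^bsub>N\<^esub> y \<in> K"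
  proof -
    have "\<ominus>\<^bsub>N\<^esub> (x \<ominus>\<^bsub>N\<^esub> y) = y \<ominus>\<^bsub>N\<^esub> x"
      using x y by (simp add: a_minus_def N.M.minus_add N.M.a_comm)
    then show ?thesis using K(3)[OF that] by simp
  qed
  have "x \<ominus>\<^bsub>N\<^esub> x \<in> K"
    using subgroup.one_closed[OF submodule.axioms(1)[OF assms(2)]] x by (simp add: a_minus_def N.M.r_neg)
  then show ?thesis
    using trans[of _ x y] trans[of _ y x] sym x y by blast
qed

section \<open>Exactness and the two consequences of faithful flatness\<close>

lemma exactD:
  assumes "exact R L M N u v"
  shows "u \<in> linear_maps R L M" "v \<in> linear_maps R M N"
    "x \<in> carrier M \<Longrightarrow> v x = \<zero>\<^bsub>N\<^esub> \<longleftrightarrow> x \<in> u ` carrier L"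
  using assms by (auto simp: exact_def kernel_def)

lemma exactI:
  assumes "module R L" "module R M" "module R N" "u \<in> linear_maps R L M" "v \<in> linear_maps R M N"
    and "\<And>x. x \<in> carrier L \<Longrightarrow> v (u x) = \<zero>\<^bsub>N\<^esub>"
    and "\<And>x. \<lbrakk>x \<in> carrier M; v x = \<zero>\<^bsub>N\<^esub>\<rbrakk> \<Longrightarrow> x \<in> u ` carrier L"
  shows "exact R L M N u v"
  using assms linear_mapsD(1)[OF assms(4)] by (auto simp: exact_def kernel_def)

lemma faithfully_flat_exact_iff:
  fixes N1 N2 N3 :: "('a, 'u) module"
  assumes "faithfully_flat TYPE('u) R M" "module R N1" "module R N2" "module R N3"
    and "u \<in> linear_maps R N1 N2" "v \<in> linear_maps R N2 N3"
    and "\<And>x. x \<in> carrier N1 \<Longrightarrow> v (u x) = \<zero>\<^bsub>N3\<^esub>"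
  shows "exact R N1 N2 N3 u v \<longleftrightarrow>
    exact R (tensor R M N1) (tensor R M N2) (tensor R M N3) (tensor_map R M N2 u) (tensor_map R M N3 v)"
  using assms unfolding faithfully_flat_def by blast

lemma submodule_restrict:
  assumes "module R N" "submodule K R N"
  shows "module R (N\<lparr>carrier := K\<rparr>)" "(\<lambda>x. x) \<in> linear_maps R (N\<lparr>carrier := K\<rparr>) N"
proof -
  show "module R (N\<lparr>carrier := K\<rparr>)"
    using submodule.submodule_is_module[OF assms(2,1)] .
  show "(\<lambda>x. x) \<in> linear_maps R (N\<lparr>carrier := K\<rparr>) N"
    using module.submoduleE(1)[OF assms] by (intro linear_mapsI) auto
qed

text \<open>Injectivity of \<open>u\<close> is exactness of
  \<open>0 \<rightarrow> N \<rightarrow> N\<close>. Flatness is stated for one carrier type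
  \<open>'u\<close> only, so the argument runs on the copy of \<open>N\<close> given by
  \<open>e\<close>. Tensoring keeps the sequence exact, and the tensor product with zero is
  zero.\<close>

lemma faithfully_flat_injective:
  fixes N :: "('a, 'n) module" and e :: "'n \<Rightarrow> 'u"
  assumes ff: "faithfully_flat TYPE('u) R M" and N: "module R N" and e: "inj_on e (carrier N)"
    and u: "u \<in> linear_maps R N N"
    and inj: "\<And>x. \<lbrakk>x \<in> carrier N; u x = \<zero>\<^bsub>N\<^esub>\<rbrakk> \<Longrightarrow> x = \<zero>\<^bsub>N\<^esub>"
    and C: "C \<in> carrier (tensor R M N)" and zero: "tensor_map R M N u C = \<zero>\<^bsub>tensor R M N\<^esub>"
  shows "C = \<zero>\<^bsub>tensor R M N\<^esub>"
proof -
  have M: "module R M" using ff by (simp add: faithfully_flat_def)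
  interpret N: module R N by fact
  interpret MN: tensor_pair R M N by (rule tensor_pair.intro[OF M N])
  let ?N' = "image_module e N"
  let ?s = "inv_into (carrier N) e"
  note N' = image_module_inj[OF N e]
  interpret N': module R ?N' by (rule N'(1))
  interpret MN': tensor_pair R M ?N' by (rule tensor_pair.intro[OF M N'(1)])
  note s = inv_into_f_f[OF e]
  let ?Z = "?N'\<lparr>carrier := {\<zero>\<^bsub>?N'\<^esub>}\<rparr>"
  have "submodule {\<zero>\<^bsub>?N'\<^esub>} R ?N'"
    by (rule N'.submoduleI) (use N'.M.zero_closed in \<open>simp_all del: zero_image_module\<close>)
  note Z = submodule_restrict[OF N'(1) this]
  interpret MZ: tensor_pair R M ?Z by (rule tensor_pair.intro[OF M Z(1)])
  \<comment> \<open>The endomorphism \<open>u\<close> conjugated to the copy of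
    \<open>N\<close>.\<close>
  let ?u = "\<lambda>X. e (u (?s X))"
  have u': "?u \<in> linear_maps R ?N' ?N'"
    by (rule linear_maps_comp[OF linear_maps_comp[OF N'(3) u] N'(2)])
  have "exact R ?Z ?N' ?N' (\<lambda>x. x) ?u"
  proof (rule exactI)
    show "?u X = \<zero>\<^bsub>?N'\<^esub>" if "X \<in> carrier ?Z" for X
      using that s[OF N.M.zero_closed] linear_maps_zero[OF N N u] by simp
    show "X \<in> (\<lambda>x. x) ` carrier ?Z" if X: "X \<in> carrier ?N'" and 0: "?u X = \<zero>\<^bsub>?N'\<^esub>" for X
    proof -
      obtain x where x: "x \<in> carrier N" "X = e x" using X by auto
      then have "u x = \<zero>\<^bsub>N\<^esub>"
        using 0 s inj_onD[OF e] linear_mapsD(1)[OF u] by simp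
      then show ?thesis using inj[OF x(1)] x(2) by simp
    qed
  qed (use N'(1) Z u' in auto)
  then have ex: "exact R MZ.T MN'.T MN'.T (tensor_map R M ?N' (\<lambda>x. x)) (tensor_map R M ?N' ?u)"
    by (subst (asm) faithfully_flat_exact_iff[OF ff Z(1) N'(1,1) Z(2) u'])
      (use s[OF N.M.zero_closed] linear_maps_zero[OF N N u] in simp_all)
  let ?C = "tensor_map R M ?N' e C"
  note comp = tensor_map_comp[OF MN.tensor_pair_axioms]
  have C': "?C \<in> carrier MN'.T"
    using linear_mapsD(1)[OF tensor_map_linear[OF MN.tensor_pair_axioms MN'.tensor_pair_axioms N'(2)] C] .
  have "tensor_map R M ?N' ?u ?C = tensor_map R M ?N' (\<lambda>x. e (u x)) C"
    by (rule comp[OF MN'.tensor_pair_axioms MN'.tensor_pair_axioms N'(2) u' linear_maps_comp[OF u N'(2)] _ C]) (simp add: s)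
  also have "\<dots> = tensor_map R M ?N' e (tensor_map R M N u C)"
    by (rule comp[OF MN.tensor_pair_axioms MN'.tensor_pair_axioms u N'(2) linear_maps_comp[OF u N'(2)] _ C, symmetric]) simp
  also have "\<dots> = \<zero>\<^bsub>MN'.T\<^esub>"
    unfolding zero by (rule tensor_map_zero[OF MN.tensor_pair_axioms MN'.tensor_pair_axioms N'(2)])
  finally obtain D where "D \<in> carrier MZ.T" "?C = tensor_map R M ?N' (\<lambda>x. x) D"
    using exactD(3)[OF ex C'] by blast
  \<comment> \<open>A pure tensor over the zero module has second entry zero, so the whole tensor
    product vanishes.\<close>
  moreover have "D = \<zero>\<^bsub>MZ.T\<^esub>" if "D \<in> carrier MZ.T" for D
    using that
  proof (induction rule: MZ.tensor_induct)
    case (pure x y)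
    then show ?case using MZ.pure_zero_right[of x] by simp
  next
    case (add C D)
    then show ?case by (simp only: MZ.T.l_zero)
  qed
  ultimately have C0: "?C = \<zero>\<^bsub>MN'.T\<^esub>"
    using tensor_map_zero[OF MZ.tensor_pair_axioms MN'.tensor_pair_axioms Z(2)] by simp
  \<comment> \<open>Transport back: the inverse of \<open>e\<close> recovers \<open>C\<close> from
    its image in the copy, which has just been shown to be zero.\<close>
  have "C = tensor_map R M N (\<lambda>x. x) C"
    by (rule tensor_map_id[OF MN.tensor_pair_axioms C, symmetric])
  also have "\<dots> = tensor_map R M N ?s ?C"
    by (rule comp[OF MN'.tensor_pair_axioms MN.tensor_pair_axioms N'(2,3) linear_maps_id _ C, symmetric]) (simp add: s)
  also have "\<dots> = \<zero>\<^bsub>MN.T\<^esub>"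
    unfolding C0 by (rule tensor_map_zero[OF MN'.tensor_pair_axioms MN.tensor_pair_axioms N'(3)])
  finally show ?thesis .
qed

text \<open>Let \<open>N'\<close> be a copy of \<open>N\<close>. Exactness of \<open>K' \<rightarrow> N' \<rightarrow> N'/K'\<close> and the hypothesis give exactness of
  \<open>M \<otimes> K \<rightarrow> M \<otimes> N' \<rightarrow> M \<otimes> N'/K'\<close>, hence of \<open>K \<rightarrow> N' \<rightarrow> N'/K'\<close>.\<close>

lemma faithfully_flat_reflects_subset:
  fixes N :: "('a, 'n) module" and e :: "'n \<Rightarrow> 'v"
  assumes ff: "faithfully_flat TYPE('v set) R M" and N: "module R N" and e: "inj_on e (carrier N)"
    and K: "submodule K R N" and K': "submodule K' R N" and sub: "K \<subseteq> K'"
    and im: "\<And>x k. \<lbrakk>x \<in> carrier M; k \<in> K'\<rbrakk> \<Longrightarrow> pure_tensor R M N x k \<in>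
      tensor_map R M N (\<lambda>x. x) ` carrier (tensor R M (N\<lparr>carrier := K\<rparr>))"
  shows "K' = K"
proof -
  have M: "module R M" using ff by (simp add: faithfully_flat_def)
  interpret N: module R N by fact
  interpret MN: tensor_pair R M N by (rule tensor_pair.intro[OF M N])
  note subs = N.submoduleE(1)[OF K] N.submoduleE(1)[OF K']
  \<comment> \<open>Elements are encoded as singletons so that the copy of \<open>N\<close> and the
    quotient, whose elements are images of cosets under \<open>e\<close>, both have elements of type
    \<open>'v set\<close>.\<close>
  let ?e = "\<lambda>x. {e x}"
  have e': "inj_on ?e (carrier N)" using e by (auto simp: inj_on_def)
  let ?p = "\<lambda>x. e ` {z \<in> carrier N. z \<ominus>\<^bsub>N\<^esub> x \<in> K'}"
  let ?N' = "image_module ?e N" and ?Q = "image_module ?p N"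
  let ?s = "inv_into (carrier N) ?e"
  note N' = image_module_inj[OF N e'] and s = inv_into_f_f[OF e']
  interpret N': module R ?N' by (rule N'(1))
  interpret MN': tensor_pair R M ?N' by (rule tensor_pair.intro[OF M N'(1)])
  have p: "?p x = ?p y \<longleftrightarrow> x \<ominus>\<^bsub>N\<^esub> y \<in> K'" if "x \<in> carrier N" "y \<in> carrier N" for x y
    using coset_eq_iff_minus_mem[OF N K' that] inj_on_image_eq_iff[OF e] by auto
  note Q = image_module[OF N K' p]
  let ?q = "\<lambda>X. ?p (?s X)"
  have q: "?q \<in> linear_maps R ?N' ?Q"
    by (rule linear_maps_comp[OF N'(3) Q(2)])
  have q_zero: "?q (?e x) = \<zero>\<^bsub>?Q\<^esub> \<longleftrightarrow> x \<in> K'" if "x \<in> carrier N" for x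
  proof -
    have minus_0: "\<ominus>\<^bsub>N\<^esub> \<zero>\<^bsub>N\<^esub> = \<zero>\<^bsub>N\<^esub>"
      by (rule N.M.minus_equality) simp_all
    show ?thesis
      using p[OF that N.M.zero_closed] that s[OF that] by (simp add: a_minus_def minus_0)
  qed
  have copy: "submodule (?e ` H) R ?N'" if "submodule H R N" for H
  proof -
    note H = N.submoduleE[OF that]
    have add: "?e x \<oplus>\<^bsub>?N'\<^esub> ?e y = ?e (x \<oplus>\<^bsub>N\<^esub> y)" if "x \<in> H" "y \<in> H" for x y
      using that H(1) linear_mapsD(2)[OF N'(2)] by (simp add: subset_eq)
    have minus: "\<ominus>\<^bsub>?N'\<^esub> ?e x = ?e (\<ominus>\<^bsub>N\<^esub> x)" if "x \<in> H" for x
      using that H(1) linear_maps_minus[OF N N'(1,2)] by (simp add: subset_eq)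
    have smult: "a \<odot>\<^bsub>?N'\<^esub> ?e x = ?e (a \<odot>\<^bsub>N\<^esub> x)" if "a \<in> carrier R" "x \<in> H" for a x
      using that H(1) linear_mapsD(3)[OF N'(2)] by (simp add: subset_eq)
    have "\<zero>\<^bsub>N\<^esub> \<in> H"
      using subgroup.one_closed[OF submodule.axioms(1)[OF that]] by simp
    then show ?thesis
      by (intro N'.submoduleI) (use H in \<open>auto simp: add minus smult\<close>)
  qed
  let ?K = "?N'\<lparr>carrier := ?e ` K\<rparr>" and ?K' = "?N'\<lparr>carrier := ?e ` K'\<rparr>"
  note resK = submodule_restrict[OF N'(1) copy[OF K]] and resK' = submodule_restrict[OF N'(1) copy[OF K']]
  interpret MK: tensor_pair R M ?K by (rule tensor_pair.intro[OF M resK(1)])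
  interpret MK': tensor_pair R M ?K' by (rule tensor_pair.intro[OF M resK'(1)])
  have complex: "?q X = \<zero>\<^bsub>?Q\<^esub>" if "X \<in> carrier ?K'" for X
  proof -
    from that obtain x where x: "x \<in> K'" "X = ?e x" by auto
    then have "x \<in> carrier N" using subs by auto
    from iffD2[OF q_zero[OF this] x(1)] show ?thesis unfolding x(2) .
  qed
  have complex_K: "?q X = \<zero>\<^bsub>?Q\<^esub>" if "X \<in> carrier ?K" for X
    by (rule complex) (use that sub in auto)
  \<comment> \<open>The equivalence is used from left to right for \<open>K'\<close> and from right
    to left for \<open>K\<close>.\<close>
  note ff_K' = faithfully_flat_exact_iff[OF ff resK'(1) N'(1) Q(1) resK'(2) q complex]
    and ff_K = faithfully_flat_exact_iff[OF ff resK(1) N'(1) Q(1) resK(2) q complex_K]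
  let ?\<iota> = "tensor_map R M ?N' (\<lambda>x. x)"
  have "exact R ?K' ?N' ?Q (\<lambda>x. x) ?q"
    by (rule exactI[OF resK'(1) N'(1) Q(1) resK'(2) q complex]) (use q_zero in auto)
  then have ex: "exact R MK'.T MN'.T (tensor R M ?Q) ?\<iota> (tensor_map R M ?Q ?q)"
    using ff_K' by blast
  note lin_K = tensor_map_linear[OF MK.tensor_pair_axioms MN'.tensor_pair_axioms resK(2)]
    and lin_K' = tensor_map_linear[OF MK'.tensor_pair_axioms MN'.tensor_pair_axioms resK'(2)]
  note NK = submodule_restrict[OF N K]
  interpret MNK: tensor_pair R M "N\<lparr>carrier := K\<rparr>" by (rule tensor_pair.intro[OF M NK(1)])
  have e_K: "?e \<in> linear_maps R (N\<lparr>carrier := K\<rparr>) ?K"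
    using subs linear_mapsD(2-)[OF N'(2)] by (intro linear_mapsI) (auto simp: subset_eq)
  \<comment> \<open>For a pure tensor the hypothesis \<open>im\<close> yields a preimage
    \<open>D\<close> in the tensor product with \<open>K\<close>; the singleton encoding moves it to
    the tensor product with the copy of \<open>K\<close>. Sums follow by linearity.\<close>
  have image: "?\<iota> C \<in> ?\<iota> ` carrier MK.T" if "C \<in> carrier MK'.T" for C
    using that
  proof (induction rule: MK'.tensor_induct)
    case (pure x y)
    then obtain k where k: "k \<in> K'" "y = ?e k" by auto
    obtain D where D: "D \<in> carrier MNK.T" "MN.pure x k = tensor_map R M N (\<lambda>x. x) D"
      using im[OF pure(1) k(1)] by blast
    have "?\<iota> (MK'.pure x y) = tensor_map R M ?N' ?e (MN.pure x k)"
      by (simp add: k tensor_map_pure[OF MK'.tensor_pair_axioms MN'.tensor_pair_axioms resK'(2)]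
          tensor_map_pure[OF MN.tensor_pair_axioms MN'.tensor_pair_axioms N'(2)])
    also have "\<dots> = tensor_map R M ?N' ?e D"
      unfolding D(2)
      by (rule tensor_map_comp[OF MNK.tensor_pair_axioms MN.tensor_pair_axioms MN'.tensor_pair_axioms NK(2) N'(2)
            linear_maps_comp[OF NK(2) N'(2)] _ D(1)]) simp
    also have "\<dots> = ?\<iota> (tensor_map R M ?K ?e D)"
      by (rule tensor_map_comp[OF MNK.tensor_pair_axioms MK.tensor_pair_axioms MN'.tensor_pair_axioms e_K resK(2)
            linear_maps_comp[OF NK(2) N'(2)] _ D(1), symmetric]) simp
    finally show ?case
      using linear_mapsD(1)[OF tensor_map_linear[OF MNK.tensor_pair_axioms MK.tensor_pair_axioms e_K] D(1)] by blast
  next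
    case (add C D)
    then obtain C' D' where "?\<iota> C = ?\<iota> C'" "?\<iota> D = ?\<iota> D'" and mem: "C' \<in> carrier MK.T" "D' \<in> carrier MK.T"
      by blast
    then have "?\<iota> (C \<oplus>\<^bsub>MK'.T\<^esub> D) = ?\<iota> (C' \<oplus>\<^bsub>MK.T\<^esub> D')"
      using add by (simp add: linear_mapsD(2)[OF lin_K] linear_mapsD(2)[OF lin_K'])
    then show ?case using mem by blast
  qed
  have "exact R MK.T MN'.T (tensor R M ?Q) ?\<iota> (tensor_map R M ?Q ?q)"
  proof (rule exactI)
    fix C assume C: "C \<in> carrier MK.T"
    \<comment> \<open>The inclusion of \<open>K\<close> factors through that of \<open>K'\<close>,
      so the vanishing of the composite is inherited from the exact sequence of
      \<open>K'\<close>.\<close>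
    have lin: "(\<lambda>x. x) \<in> linear_maps R ?K ?K'"
      using sub by (intro linear_mapsI) auto
    have "?\<iota> C = ?\<iota> (tensor_map R M ?K' (\<lambda>x. x) C)"
      by (rule tensor_map_comp[OF MK.tensor_pair_axioms MK'.tensor_pair_axioms MN'.tensor_pair_axioms lin resK'(2)
            resK(2) _ C, symmetric]) simp
    moreover have "tensor_map R M ?K' (\<lambda>x. x) C \<in> carrier MK'.T"
      by (rule linear_mapsD(1)[OF tensor_map_linear[OF MK.tensor_pair_axioms MK'.tensor_pair_axioms lin] C])
    ultimately have "?\<iota> C \<in> ?\<iota> ` carrier MK'.T"
      by (rule image_eqI)
    then show "tensor_map R M ?Q ?q (?\<iota> C) = \<zero>\<^bsub>tensor R M ?Q\<^esub>"
      by (rule iffD2[OF exactD(3)[OF ex linear_mapsD(1)[OF lin_K C]]])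
  next
    fix C assume "C \<in> carrier MN'.T" "tensor_map R M ?Q ?q C = \<zero>\<^bsub>tensor R M ?Q\<^esub>"
    then have "C \<in> ?\<iota> ` carrier MK'.T"
      by (rule iffD1[OF exactD(3)[OF ex]])
    then show "C \<in> ?\<iota> ` carrier MK.T"
      by (elim imageE) (simp only: image)
  qed (use lin_K exactD(2)[OF ex] MK.module_tensor MN'.module_tensor in
      \<open>auto intro!: tensor_pair.module_tensor tensor_pair.intro M Q(1)\<close>)
  then have "exact R ?K ?N' ?Q (\<lambda>x. x) ?q"
    using ff_K by blast
  note ex_K = exactD(3)[OF this]
  \<comment> \<open>An element of \<open>K'\<close> dies in the quotient, so exactness for
    \<open>K\<close> puts its copy into the copy of \<open>K\<close>; injectivity of
    \<open>e\<close> then returns to \<open>N\<close>.\<close>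
  have "x \<in> K" if "x \<in> K'" for x
  proof -
    have x: "x \<in> carrier N" using that subs by auto
    from iffD2[OF q_zero[OF x] that] have "?e x \<in> (\<lambda>x. x) ` carrier ?K"
      by (rule iffD1[OF ex_K, rotated]) (use x in simp)
    then obtain y where "y \<in> K" "e x = e y" by auto
    moreover from this x subs have "x = y" by (intro inj_onD[OF e]) auto
    ultimately show ?thesis by simp
  qed
  then show ?thesis using sub by blast
qed

section \<open>Radicals and localizations\<close>

lemma (in abelian_group) minus_eq_zeroD:
  assumes "a \<in> carrier G" "b \<in> carrier G" "a \<ominus> b = \<zero>"
  shows "a = b"
  using assms minus_equality[of a "\<ominus> b"] by (simp add: minus_eq)

section \<open>Radicals of ideals\<close>

context cring
begin

lemma mem_cgenideal: "a \<in> PIdl f \<longleftrightarrow> (\<exists>x\<in>carrier R. a = x \<otimes> f)"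
  by (auto simp: cgenideal_def)

text \<open>Induction on the exponent of \<open>a \<oplus> b\<close>; this replaces the binomial theorem.\<close>

lemma mixed_power_mem_ideal:
  assumes "ideal I R" and a: "a \<in> carrier R" and b: "b \<in> carrier R"
    and an: "a [^] n \<in> I" and bm: "b [^] m \<in> I"
  shows "n + m \<le> i + j + k \<Longrightarrow> a [^] i \<otimes> b [^] j \<otimes> (a \<oplus> b) [^] (k::nat) \<in> I"
proof (induction k arbitrary: i j)
  case 0
  interpret ideal I R by fact
  \<comment> \<open>With no factor \<open>a \<oplus> b\<close> left, the bound forces
    \<open>i >= n\<close> or \<open>j >= m\<close>, and then one of the two powers already lies in
    the ideal.\<close>
  from 0 consider "i = n + (i - n)" | "j = m + (j - m)" by linarith
  then show ?case
  proof cases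
    case 1
    then have "a [^] i = a [^] n \<otimes> a [^] (i - n)" using a by (metis nat_pow_mult)
    then show ?thesis using a b an by (simp add: I_r_closed)
  next
    case 2
    then have "b [^] j = b [^] m \<otimes> b [^] (j - m)" using b by (metis nat_pow_mult)
    then show ?thesis using a b bm by (simp add: I_l_closed I_r_closed)
  qed
next
  case (Suc k)
  interpret ideal I R by fact
  let ?c = "(a \<oplus> b) [^] k"
  \<comment> \<open>Expanding one factor \<open>a \<oplus> b\<close> gives two terms with one more
    \<open>a\<close> or one more \<open>b\<close>, so the total exponent is unchanged.\<close>
  have "a [^] i \<otimes> b [^] j \<otimes> (a \<oplus> b) [^] Suc k =
      a [^] Suc i \<otimes> b [^] j \<otimes> ?c \<oplus> a [^] i \<otimes> b [^] Suc j \<otimes> ?c"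
    using a b by (simp add: l_distr r_distr m_ac)
  moreover have "a [^] Suc i \<otimes> b [^] j \<otimes> ?c \<in> I" "a [^] i \<otimes> b [^] Suc j \<otimes> ?c \<in> I"
    using Suc.prems by (intro Suc.IH; simp)+
  ultimately show ?case by (simp only: a_closed)
qed

lemma radical_ideal:
  assumes "ideal I R"
  shows "radical R I \<subseteq> carrier R"
    and "\<zero> \<in> radical R I"
    and "\<lbrakk>a \<in> radical R I; b \<in> radical R I\<rbrakk> \<Longrightarrow> a \<oplus> b \<in> radical R I"
    and "\<lbrakk>r \<in> carrier R; a \<in> radical R I\<rbrakk> \<Longrightarrow> r \<otimes> a \<in> radical R I"
proof -
  interpret ideal I R by fact
  show "radical R I \<subseteq> carrier R" by (auto simp: radical_def)
  show "\<zero> \<in> radical R I"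
    \<comment> \<open>The exponent is \<open>1\<close>, since \<open>radical\<close> admits only
      positive exponents.\<close>
    unfolding radical_def by (auto intro!: exI[of _ "1::nat"] simp: zero_closed)
  show "a \<oplus> b \<in> radical R I" if ab: "a \<in> radical R I" "b \<in> radical R I"
  proof -
    obtain n m :: nat where nm: "a [^] n \<in> I" "b [^] m \<in> I" "n > 0" and mem: "a \<in> carrier R" "b \<in> carrier R"
      using ab by (auto simp: radical_def)
    have "a [^] (0::nat) \<otimes> b [^] (0::nat) \<otimes> (a \<oplus> b) [^] (n + m) \<in> I"
      using assms mem nm by (intro mixed_power_mem_ideal) auto
    then have "(a \<oplus> b) [^] (n + m) \<in> I"
      using mem by simp
    moreover have "n + m > 0" using \<open>n > 0\<close> by simp
    ultimately show ?thesis
      using mem unfolding radical_def by blast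
  qed
  show "r \<otimes> a \<in> radical R I" if "r \<in> carrier R" "a \<in> radical R I"
    using that by (auto simp: radical_def nat_pow_distrib intro!: I_l_closed)
qed

end

text \<open>Apply \<open>\<phi>\<close> to the equation \<open>a^n = c f\<close>. This is what makes
  the induced maps of localizations restrict to \<open>MO\<close>.\<close>

lemma radical_cgenideal_hom:
  assumes "cring A" "cring B" and \<phi>: "\<phi> \<in> ring_hom A B" and f: "f \<in> carrier A"
    and a: "a \<in> radical A (PIdl\<^bsub>A\<^esub> f)"
  shows "\<phi> a \<in> radical B (PIdl\<^bsub>B\<^esub> \<phi> f)"
proof -
  interpret A: cring A by fact
  interpret B: cring B by fact
  interpret \<phi>: ring_hom_ring A B \<phi>
    by (rule ring_hom_ringI2[OF A.ring_axioms B.ring_axioms \<phi>])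
  obtain n c where "n > 0" "a [^]\<^bsub>A\<^esub> (n::nat) = c \<otimes>\<^bsub>A\<^esub> f" "c \<in> carrier A" and mem: "a \<in> carrier A"
    using a by (auto simp: radical_def A.mem_cgenideal)
  then have "\<phi> a [^]\<^bsub>B\<^esub> n = \<phi> c \<otimes>\<^bsub>B\<^esub> \<phi> f"
    using f by (metis \<phi>.hom_mult \<phi>.hom_nat_pow)
  then show ?thesis
    using \<open>n > 0\<close> \<open>c \<in> carrier A\<close> mem unfolding radical_def B.mem_cgenideal
    by (blast intro: \<phi>.hom_closed)
qed

section \<open>Localization at a nonzero divisor\<close>

locale nonzero_divisor_localization = cring R for R :: "('a, 'r) ring_scheme" (structure) +
  fixes f :: 'a
  assumes nzd: "nonzero_divisor R f"
begin

abbreviation "S \<equiv> powers R f"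
abbreviation "L \<equiv> localization R f"

lemma f_closed [simp]: "f \<in> carrier R"
  using nzd by (simp add: nonzero_divisor_def)

lemma powers_closed [simp]: "s \<in> S \<Longrightarrow> s \<in> carrier R"
  by (auto simp: powers_def)

lemma one_powers [simp]: "\<one> \<in> S"
  unfolding powers_def by (rule range_eqI[of _ _ 0]) simp

lemma f_powers [simp]: "f \<in> S"
  unfolding powers_def by (rule range_eqI[of _ _ 1]) simp

lemma mult_powers [simp]: "\<lbrakk>s \<in> S; t \<in> S\<rbrakk> \<Longrightarrow> s \<otimes> t \<in> S"
  by (auto simp: powers_def nat_pow_mult)

text \<open>A power of a nonzero divisor is again one, as its factors \<open>f\<close> can be
  removed one at a time; cancellation is this fact applied to a difference.\<close>

lemma powers_cancel:
  assumes "s \<in> S" "a \<in> carrier R" "b \<in> carrier R" "s \<otimes> a = s \<otimes> b"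
  shows "a = b"
proof -
  have pow: "f [^] n \<otimes> c = \<zero> \<Longrightarrow> c = \<zero>" if "c \<in> carrier R" for n :: nat and c
  proof (induction n)
    case (Suc n)
    then have "f \<otimes> (f [^] n \<otimes> c) = \<zero>" using that by (simp add: m_ac)
    then have "f [^] n \<otimes> c = \<zero>" using nzd that unfolding nonzero_divisor_def by blast
    then show ?case by (rule Suc.IH)
  qed (use that in simp)
  have "s \<otimes> (a \<ominus> b) = \<zero>"
    using assms by (simp add: a_minus_def r_distr r_minus r_neg)
  then have "a \<ominus> b = \<zero>"
    using pow[of "a \<ominus> b"] assms by (auto simp: powers_def)
  then show ?thesis
    using assms by (simp add: minus_eq_zeroD)
qed

text \<open>The auxiliary factor \<open>u\<close> of the fraction relation is a power of
  \<open>f\<close> and cancels, which leaves plain cross-multiplication.\<close>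

lemma frac_rel_iff:
  "((a, s), (b, t)) \<in> frac_rel R f \<longleftrightarrow>
    a \<in> carrier R \<and> b \<in> carrier R \<and> s \<in> S \<and> t \<in> S \<and> a \<otimes> t = b \<otimes> s"
proof -
  have "(\<exists>u\<in>S. u \<otimes> (a \<otimes> t) = u \<otimes> (b \<otimes> s)) \<longleftrightarrow> a \<otimes> t = b \<otimes> s" (is "?l \<longleftrightarrow> ?r")
    if mem: "a \<in> carrier R" "b \<in> carrier R" "s \<in> S" "t \<in> S"
  proof
    assume ?l
    then obtain u where "u \<in> S" "u \<otimes> (a \<otimes> t) = u \<otimes> (b \<otimes> s)" ..
    then show ?r
      using mem powers_cancel[of u "a \<otimes> t" "b \<otimes> s"] by simp
  next
    assume ?r
    then show ?l by (intro bexI[OF _ one_powers]) simp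
  qed
  then show ?thesis
    by (simp add: frac_rel_def cong: conj_cong)
qed

lemma frac_rel_equiv: "equiv (carrier R \<times> S) (frac_rel R f)"
proof (rule equivI)
  show "sym (frac_rel R f)"
    by (rule symI, clarify) (simp add: frac_rel_iff)
  show "trans (frac_rel R f)"
  proof (rule transI, clarify)
    fix a s b t c u
    assume 1: "((a, s), (b, t)) \<in> frac_rel R f" and 2: "((b, t), (c, u)) \<in> frac_rel R f"
    then have mem: "a \<in> carrier R" "b \<in> carrier R" "c \<in> carrier R" "s \<in> S" "t \<in> S" "u \<in> S"
      and eq: "a \<otimes> t = b \<otimes> s" "b \<otimes> u = c \<otimes> t"
      by (auto simp: frac_rel_iff)
    \<comment> \<open>Transitivity is shown after multiplication by \<open>t\<close>, which is then
      cancelled as a power of \<open>f\<close>.\<close>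
    have "t \<otimes> (a \<otimes> u) = (a \<otimes> t) \<otimes> u" using mem by (simp add: m_ac)
    also have "\<dots> = (b \<otimes> u) \<otimes> s" unfolding eq(1) using mem by (simp add: m_ac)
    also have "\<dots> = t \<otimes> (c \<otimes> s)" unfolding eq(2) using mem by (simp add: m_ac)
    finally have "a \<otimes> u = c \<otimes> s"
      using mem powers_cancel[of t "a \<otimes> u" "c \<otimes> s"] by simp
    then show "((a, s), (c, u)) \<in> frac_rel R f" using mem by (simp add: frac_rel_iff)
  qed
  show "refl_on (carrier R \<times> S) (frac_rel R f)"
    by (rule refl_onI, clarify) (simp add: frac_rel_iff)
  show "frac_rel R f \<subseteq> (carrier R \<times> S) \<times> carrier R \<times> S"
    by (rule subsetI, clarify) (simp add: frac_rel_iff)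
qed

lemma frac_eq_iff:
  assumes "a \<in> carrier R" "s \<in> S" "b \<in> carrier R" "t \<in> S"
  shows "frac R f a s = frac R f b t \<longleftrightarrow> a \<otimes> t = b \<otimes> s"
  unfolding frac_def using assms
  by (subst eq_equiv_class_iff[OF frac_rel_equiv]) (auto simp: frac_rel_iff)

lemma mem_frac:
  assumes "a \<in> carrier R" "s \<in> S"
  shows "(b, t) \<in> frac R f a s \<longleftrightarrow> b \<in> carrier R \<and> t \<in> S \<and> a \<otimes> t = b \<otimes> s"
  using assms by (auto simp: frac_def frac_rel_iff)

lemma carrier_localization: "carrier L = {frac R f a s | a s. a \<in> carrier R \<and> s \<in> S}"
  by (auto simp: localization_def quotient_def frac_def)

lemma frac_closed [simp]: "\<lbrakk>a \<in> carrier R; s \<in> S\<rbrakk> \<Longrightarrow> frac R f a s \<in> carrier L"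
  by (auto simp: carrier_localization)

lemma localizationE:
  assumes "x \<in> carrier L"
  obtains a s where "x = frac R f a s" "a \<in> carrier R" "s \<in> S"
  using assms by (auto simp: carrier_localization)

text \<open>The counterpart of \<open>UN_cls\<close> for fractions.\<close>

lemma UN_frac:
  assumes "a \<in> carrier R" "s \<in> S"
    and "\<And>a' s'. \<lbrakk>a' \<in> carrier R; s' \<in> S; a \<otimes> s' = a' \<otimes> s\<rbrakk> \<Longrightarrow> G a' s' = G a s"
  shows "(\<Union>(a', s')\<in>frac R f a s. G a' s') = G a s"
proof -
  have "(a, s) \<in> frac R f a s"
    using assms(1,2) by (simp add: mem_frac)
  moreover have "case_prod G z = G a s" if "z \<in> frac R f a s" for z
  proof (cases z)
    case (Pair a' s')
    with that have "a' \<in> carrier R" "s' \<in> S" "a \<otimes> s' = a' \<otimes> s"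
      using assms(1,2) by (simp_all add: mem_frac)
    from assms(3)[OF this] show ?thesis by (simp only: Pair prod.case)
  qed
  ultimately show ?thesis
    by (intro SUP_eq_const) blast+
qed

lemma frac_mult:
  assumes a: "a \<in> carrier R" "s \<in> S" and b: "b \<in> carrier R" "t \<in> S"
  shows "frac R f a s \<otimes>\<^bsub>L\<^esub> frac R f b t = frac R f (a \<otimes> b) (s \<otimes> t)"
proof -
  have "frac R f a s \<otimes>\<^bsub>L\<^esub> frac R f b t =
      (\<Union>(a, s)\<in>frac R f a s. \<Union>(b, t)\<in>frac R f b t. frac R f (a \<otimes> b) (s \<otimes> t))"
    by (simp add: localization_def)
  \<comment> \<open>The inner union is collapsed first, for an arbitrary representative of the left
    fraction; the outer one follows.\<close>
  also have "\<dots> = (\<Union>(a, s)\<in>frac R f a s. frac R f (a \<otimes> b) (s \<otimes> t))"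
  proof (intro SUP_cong refl, clarify)
    fix a' s' assume "(a', s') \<in> frac R f a s"
    then have a': "a' \<in> carrier R" "s' \<in> S" using a by (auto simp: mem_frac)
    show "(\<Union>(b, t)\<in>frac R f b t. frac R f (a' \<otimes> b) (s' \<otimes> t)) = frac R f (a' \<otimes> b) (s' \<otimes> t)"
    proof (rule UN_frac[OF b])
      fix b' t' assume b': "b' \<in> carrier R" "t' \<in> S" and eq: "b \<otimes> t' = b' \<otimes> t"
      have "a' \<otimes> b' \<otimes> (s' \<otimes> t) = a' \<otimes> s' \<otimes> (b' \<otimes> t)" using a' b b' by (simp add: m_ac)
      also have "\<dots> = a' \<otimes> b \<otimes> (s' \<otimes> t')" unfolding eq[symmetric] using a' b b' by (simp add: m_ac)
      finally show "frac R f (a' \<otimes> b') (s' \<otimes> t') = frac R f (a' \<otimes> b) (s' \<otimes> t)"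
        using a' b b' by (subst frac_eq_iff) auto
    qed
  qed
  also have "\<dots> = frac R f (a \<otimes> b) (s \<otimes> t)"
  proof (rule UN_frac[OF a])
    fix a' s' assume a': "a' \<in> carrier R" "s' \<in> S" and eq: "a \<otimes> s' = a' \<otimes> s"
    have "a' \<otimes> b \<otimes> (s \<otimes> t) = a' \<otimes> s \<otimes> (b \<otimes> t)" using a a' b by (simp add: m_ac)
    also have "\<dots> = a \<otimes> b \<otimes> (s' \<otimes> t)" unfolding eq[symmetric] using a a' b by (simp add: m_ac)
    finally show "frac R f (a' \<otimes> b) (s' \<otimes> t) = frac R f (a \<otimes> b) (s \<otimes> t)"
      using a a' b by (subst frac_eq_iff) auto
  qed
  finally show ?thesis .
qed

lemma frac_add:
  assumes a: "a \<in> carrier R" "s \<in> S" and b: "b \<in> carrier R" "t \<in> S"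
  shows "frac R f a s \<oplus>\<^bsub>L\<^esub> frac R f b t = frac R f (a \<otimes> t \<oplus> b \<otimes> s) (s \<otimes> t)"
proof -
  have "frac R f a s \<oplus>\<^bsub>L\<^esub> frac R f b t =
      (\<Union>(a, s)\<in>frac R f a s. \<Union>(b, t)\<in>frac R f b t. frac R f (a \<otimes> t \<oplus> b \<otimes> s) (s \<otimes> t))"
    by (simp add: localization_def)
  also have "\<dots> = (\<Union>(a, s)\<in>frac R f a s. frac R f (a \<otimes> t \<oplus> b \<otimes> s) (s \<otimes> t))"
  proof (intro SUP_cong refl, clarify)
    fix a' s' assume "(a', s') \<in> frac R f a s"
    then have a': "a' \<in> carrier R" "s' \<in> S" using a by (auto simp: mem_frac)
    show "(\<Union>(b, t)\<in>frac R f b t. frac R f (a' \<otimes> t \<oplus> b \<otimes> s') (s' \<otimes> t)) =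
        frac R f (a' \<otimes> t \<oplus> b \<otimes> s') (s' \<otimes> t)"
    proof (rule UN_frac[OF b])
      fix b' t' assume b': "b' \<in> carrier R" "t' \<in> S" and eq: "b \<otimes> t' = b' \<otimes> t"
      have "(a' \<otimes> t' \<oplus> b' \<otimes> s') \<otimes> (s' \<otimes> t) = a' \<otimes> t \<otimes> (s' \<otimes> t') \<oplus> (b' \<otimes> t) \<otimes> (s' \<otimes> s')"
        using a' b b' by (simp add: l_distr r_distr m_ac)
      also have "\<dots> = (a' \<otimes> t \<oplus> b \<otimes> s') \<otimes> (s' \<otimes> t')"
        unfolding eq[symmetric] using a' b b' by (simp add: l_distr r_distr m_ac)
      finally show "frac R f (a' \<otimes> t' \<oplus> b' \<otimes> s') (s' \<otimes> t') = frac R f (a' \<otimes> t \<oplus> b \<otimes> s') (s' \<otimes> t)"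
        using a' b b' by (subst frac_eq_iff) auto
    qed
  qed
  also have "\<dots> = frac R f (a \<otimes> t \<oplus> b \<otimes> s) (s \<otimes> t)"
  proof (rule UN_frac[OF a])
    fix a' s' assume a': "a' \<in> carrier R" "s' \<in> S" and eq: "a \<otimes> s' = a' \<otimes> s"
    have "(a' \<otimes> t \<oplus> b \<otimes> s') \<otimes> (s \<otimes> t) = a' \<otimes> s \<otimes> (t \<otimes> t) \<oplus> b \<otimes> s \<otimes> (s' \<otimes> t)"
      using a a' b by (simp add: l_distr r_distr m_ac)
    also have "\<dots> = (a \<otimes> t \<oplus> b \<otimes> s) \<otimes> (s' \<otimes> t)"
      unfolding eq[symmetric] using a a' b by (simp add: l_distr r_distr m_ac)
    finally show "frac R f (a' \<otimes> t \<oplus> b \<otimes> s') (s' \<otimes> t) = frac R f (a \<otimes> t \<oplus> b \<otimes> s) (s \<otimes> t)"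
      using a a' b by (subst frac_eq_iff) auto
  qed
  finally show ?thesis .
qed

lemma frac_smult:
  assumes a: "a \<in> carrier R" and b: "b \<in> carrier R" "t \<in> S"
  shows "a \<odot>\<^bsub>L\<^esub> frac R f b t = frac R f (a \<otimes> b) t"
proof -
  have "a \<odot>\<^bsub>L\<^esub> frac R f b t = (\<Union>(b, t)\<in>frac R f b t. frac R f (a \<otimes> b) t)"
    by (simp add: localization_def)
  also have "\<dots> = frac R f (a \<otimes> b) t"
  proof (rule UN_frac[OF b])
    fix b' t' assume b': "b' \<in> carrier R" "t' \<in> S" and eq: "b \<otimes> t' = b' \<otimes> t"
    then show "frac R f (a \<otimes> b') t' = frac R f (a \<otimes> b) t"
      using a b by (subst frac_eq_iff) (auto simp: m_assoc)
  qed
  finally show ?thesis .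
qed

lemma localization_one_zero: "\<one>\<^bsub>L\<^esub> = frac R f \<one> \<one>" "\<zero>\<^bsub>L\<^esub> = frac R f \<zero> \<one>"
  by (simp_all add: localization_def)

lemma frac_zero:
  assumes "s \<in> S"
  shows "frac R f \<zero> s = \<zero>\<^bsub>L\<^esub>"
  using assms by (simp add: localization_one_zero frac_eq_iff)

lemma frac_eq_zero_iff:
  assumes "a \<in> carrier R" "s \<in> S"
  shows "frac R f a s = \<zero>\<^bsub>L\<^esub> \<longleftrightarrow> a = \<zero>"
  using assms by (simp add: localization_one_zero frac_eq_iff)

text \<open>The general sum has denominator \<open>s \<otimes> s\<close>, one factor of which
  cancels. In \<open>MO\<close> all fractions are written over \<open>f\<close>, so sums there take
  this form.\<close>

lemma frac_add_same:
  assumes "a \<in> carrier R" "b \<in> carrier R" "s \<in> S"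
  shows "frac R f a s \<oplus>\<^bsub>L\<^esub> frac R f b s = frac R f (a \<oplus> b) s"
  using assms by (simp add: frac_add) (simp add: frac_eq_iff l_distr r_distr m_ac)

lemma frac_self: "s \<in> S \<Longrightarrow> frac R f s s = \<one>\<^bsub>L\<^esub>"
  by (simp add: localization_one_zero frac_eq_iff)

lemma localization_cring: "cring L"
proof (rule cringI)
  show "abelian_group L"
  proof (rule abelian_groupI)
    fix x assume "x \<in> carrier L"
    then obtain a s where x: "x = frac R f a s" "a \<in> carrier R" "s \<in> S"
      by (rule localizationE)
    then have "frac R f (\<ominus> a) s \<oplus>\<^bsub>L\<^esub> x = \<zero>\<^bsub>L\<^esub>"
      by (simp add: frac_add_same l_neg frac_zero)
    then show "\<exists>y\<in>carrier L. y \<oplus>\<^bsub>L\<^esub> x = \<zero>\<^bsub>L\<^esub>"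
      using x by (meson frac_closed a_inv_closed)
  qed (auto elim!: localizationE simp: frac_add localization_one_zero frac_eq_iff l_distr r_distr m_ac a_ac)
  show "comm_monoid L"
    by (rule comm_monoidI)
      (auto elim!: localizationE simp: frac_mult localization_one_zero frac_eq_iff m_ac)
next
  fix x y z assume "x \<in> carrier L" "y \<in> carrier L" "z \<in> carrier L"
  then show "(x \<oplus>\<^bsub>L\<^esub> y) \<otimes>\<^bsub>L\<^esub> z = x \<otimes>\<^bsub>L\<^esub> z \<oplus>\<^bsub>L\<^esub> y \<otimes>\<^bsub>L\<^esub> z"
    by (elim localizationE) (simp add: frac_add frac_mult frac_eq_iff, simp add: l_distr r_distr m_ac a_ac)
qed

sublocale L: cring L
  by (rule localization_cring)

lemma localization_module: "module R L"
proof (rule moduleI)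
  fix a b x assume a: "a \<in> carrier R" "b \<in> carrier R" and "x \<in> carrier L"
  then obtain c s where x: "x = frac R f c s" "c \<in> carrier R" "s \<in> S"
    by (elim localizationE)
  show "(a \<oplus> b) \<odot>\<^bsub>L\<^esub> x = a \<odot>\<^bsub>L\<^esub> x \<oplus>\<^bsub>L\<^esub> b \<odot>\<^bsub>L\<^esub> x"
    using a x by (simp add: frac_smult frac_add_same l_distr)
qed (auto elim!: localizationE simp: cring_axioms L.abelian_group_axioms frac_add frac_smult
    frac_eq_iff l_distr r_distr m_ac a_ac)

lemma frac_minus_same:
  assumes "a \<in> carrier R" "b \<in> carrier R" "s \<in> S"
  shows "frac R f a s \<ominus>\<^bsub>L\<^esub> frac R f b s = frac R f (a \<ominus> b) s"
proof -
  have "frac R f (\<ominus> b) s \<oplus>\<^bsub>L\<^esub> frac R f b s = \<zero>\<^bsub>L\<^esub>"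
    using assms by (simp add: frac_add_same l_neg frac_zero)
  then have "\<ominus>\<^bsub>L\<^esub> frac R f b s = frac R f (\<ominus> b) s"
    using assms by (intro L.minus_equality) auto
  then show ?thesis
    using assms by (simp add: a_minus_def frac_add_same)
qed

lemma frac_inv:
  assumes "s \<in> S"
  shows "inv\<^bsub>L\<^esub> (frac R f s \<one>) = frac R f \<one> s"
  using assms by (intro L.comm_inv_char) (simp_all add: frac_mult frac_self)

section \<open>Fractions over \<open>f\<close> with numerator in the radical\<close>

abbreviation "rad \<equiv> radical R (PIdl f)"

lemma rad_closed [simp]: "a \<in> rad \<Longrightarrow> a \<in> carrier R"
  using radical_ideal(1)[OF cgenideal_ideal[OF f_closed]] by auto

lemmas rad_ideal = radical_ideal(2-)[OF cgenideal_ideal[OF f_closed]]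

lemma MO_simps:
  "carrier (MO R f) = {frac R f a f | a. a \<in> rad}"
  "add (MO R f) = add L" "\<zero>\<^bsub>MO R f\<^esub> = \<zero>\<^bsub>L\<^esub>" "smult (MO R f) = smult L"
  by (simp_all add: MO_def)

text \<open>Closure holds because the radical is an ideal; the laws are inherited from the
  localization.\<close>

lemma MO_module: "module R (MO R f)"
proof -
  interpret L: module R L by (rule localization_module)
  have sub: "carrier (MO R f) \<subseteq> carrier L"
    by (auto simp: MO_simps)
  show ?thesis
  proof (rule moduleI)
    show "abelian_group (MO R f)"
    proof (rule abelian_groupI)
      show "\<zero>\<^bsub>MO R f\<^esub> \<in> carrier (MO R f)"
        using frac_zero[OF f_powers] rad_ideal(1) unfolding MO_simps by force
      fix x y assume x: "x \<in> carrier (MO R f)" and y: "y \<in> carrier (MO R f)"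
      then show "x \<oplus>\<^bsub>MO R f\<^esub> y \<in> carrier (MO R f)"
        by (auto simp: MO_simps frac_add_same intro: rad_ideal)
      from x obtain a where a: "a \<in> rad" "x = frac R f a f" by (auto simp: MO_simps)
      then have "\<ominus> a \<in> rad" using rad_ideal(3)[of "\<ominus> \<one>" a] by (simp add: l_minus)
      moreover have "frac R f (\<ominus> a) f \<oplus>\<^bsub>L\<^esub> x = \<zero>\<^bsub>L\<^esub>"
        using a by (simp add: frac_add_same l_neg frac_zero)
      ultimately show "\<exists>y\<in>carrier (MO R f). y \<oplus>\<^bsub>MO R f\<^esub> x = \<zero>\<^bsub>MO R f\<^esub>"
        unfolding MO_simps by blast
    qed (use sub in \<open>auto simp: MO_simps(2-) L.a_ac subset_eq\<close>)
    show "a \<odot>\<^bsub>MO R f\<^esub> x \<in> carrier (MO R f)" if "a \<in> carrier R" "x \<in> carrier (MO R f)" for a x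
      using that by (auto simp: MO_simps frac_smult intro: rad_ideal)
  qed (use sub in \<open>auto simp: MO_simps(2-) subset_eq cring_axioms L.smult_l_distr L.smult_r_distr L.smult_assoc1\<close>)
qed

end

text \<open>Equal fractions have equal cross products, and \<open>\<phi>\<close> preserves these; so
  all representatives give one value, and \<open>the_elem\<close> is applied to a singleton.\<close>

lemma localization_map_frac:
  assumes "nonzero_divisor_localization A f" "nonzero_divisor_localization B (\<phi> f)"
    and \<phi>: "\<phi> \<in> ring_hom A B" and a: "a \<in> carrier A" "s \<in> powers A f"
  shows "localization_map \<phi> B (\<phi> f) (frac A f a s) = frac B (\<phi> f) (\<phi> a) (\<phi> s)"
proof -
  interpret A: nonzero_divisor_localization A f by fact
  interpret B: nonzero_divisor_localization B "\<phi> f" by fact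
  interpret \<phi>: ring_hom_ring A B \<phi>
    by (rule ring_hom_ringI2[OF A.ring_axioms B.ring_axioms \<phi>])
  have S: "\<phi> t \<in> B.S" if "t \<in> A.S" for t
    using that by (auto simp: powers_def \<phi>.hom_nat_pow)
  have val: "frac B (\<phi> f) (\<phi> b) \<one>\<^bsub>B\<^esub> \<otimes>\<^bsub>B.L\<^esub> inv\<^bsub>B.L\<^esub> frac B (\<phi> f) (\<phi> t) \<one>\<^bsub>B\<^esub> = frac B (\<phi> f) (\<phi> a) (\<phi> s)"
    if "(b, t) \<in> frac A f a s" for b t
  proof -
    have b: "b \<in> carrier A" "t \<in> A.S" "a \<otimes>\<^bsub>A\<^esub> t = b \<otimes>\<^bsub>A\<^esub> s"
      using that a by (auto simp: A.mem_frac)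
    then have "\<phi> a \<otimes>\<^bsub>B\<^esub> \<phi> t = \<phi> b \<otimes>\<^bsub>B\<^esub> \<phi> s"
      using a by (metis A.powers_closed \<phi>.hom_mult)
    then show ?thesis
      using a b S by (simp add: B.frac_inv B.frac_mult B.frac_eq_iff)
  qed
  have "(a, s) \<in> frac A f a s"
    using a by (simp add: A.mem_frac)
  then have "(\<lambda>(b, t). frac B (\<phi> f) (\<phi> b) \<one>\<^bsub>B\<^esub> \<otimes>\<^bsub>B.L\<^esub> inv\<^bsub>B.L\<^esub> frac B (\<phi> f) (\<phi> t) \<one>\<^bsub>B\<^esub>) ` frac A f a s =
      {frac B (\<phi> f) (\<phi> a) (\<phi> s)}"
    using val by (auto simp: image_iff intro!: bexI[of _ "(a, s)"])
  then show ?thesis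
    unfolding localization_map_def by simp
qed

section \<open>Faithfully flat descent\<close>

lemma restrict_scalars_simps [simp]:
  "carrier (restrict_scalars \<phi> M) = carrier M"
  "\<zero>\<^bsub>restrict_scalars \<phi> M\<^esub> = \<zero>\<^bsub>M\<^esub>"
  "add (restrict_scalars \<phi> M) = add M"
  "smult (restrict_scalars \<phi> M) = (\<lambda>a x. \<phi> a \<odot>\<^bsub>M\<^esub> x)"
  by (simp_all add: restrict_scalars_def)

lemma restrict_scalars_module:
  assumes "cring A" and \<phi>: "\<phi> \<in> ring_hom A B" and "module B M"
  shows "module A (restrict_scalars \<phi> M)"
proof -
  interpret A: cring A by fact
  interpret M: module B M by fact
  interpret \<phi>: ring_hom_ring A B \<phi>
    by (rule ring_hom_ringI2[OF A.ring_axioms M.R.ring_axioms \<phi>])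
  show ?thesis
  proof (rule moduleI)
    show "abelian_group (restrict_scalars \<phi> M)"
      by (rule abelian_groupI) (auto simp: M.M.a_ac intro: M.M.add.l_inv_ex)
  qed (simp_all add: A.cring_axioms M.smult_l_distr M.smult_r_distr M.smult_assoc1)
qed

lemma module_zero_module:
  assumes "cring R"
  shows "module R zero_module"
  by (rule moduleI[OF assms abelian_groupI]) (simp_all add: zero_module_def)

section \<open>Injectivity, equalizer and nonzero divisors for a faithfully flat extension\<close>

locale faithfully_flat_extension = A: cring A + B: cring B
  for A :: "('a, 'r) ring_scheme" and B :: "('b, 's) ring_scheme" +
  fixes \<phi> :: "'a \<Rightarrow> 'b" and f :: 'a
  assumes nzd: "nonzero_divisor A f" and ff: "faithfully_flat_hom A B \<phi>"
begin

lemma hom: "\<phi> \<in> ring_hom A B"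
  using ff by (simp add: faithfully_flat_hom_def)

lemma flat: "faithfully_flat TYPE(('a + 'b) set) A (algebra_of \<phi> B)"
  using ff by (simp add: faithfully_flat_hom_def)

sublocale tensor_algebra A B B \<phi> \<phi>
  by unfold_locales (rule hom)+

sublocale \<phi>: ring_hom_ring A B \<phi>
  by (rule ring_hom_ringI2[OF A.ring_axioms B.ring_axioms hom])

abbreviation "i1 b \<equiv> pure b \<one>\<^bsub>B\<^esub>"
abbreviation "i2 b \<equiv> pure \<one>\<^bsub>B\<^esub> b"

sublocale i1: ring_hom_ring B T "\<lambda>b. i1 b"
  by (rule ring_hom_ringI2[OF B.ring_axioms Tring.ring_axioms tensor_left_hom])

sublocale i2: ring_hom_ring B T "\<lambda>b. i2 b"
  by (rule ring_hom_ringI2[OF B.ring_axioms Tring.ring_axioms tensor_right_hom])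

sublocale BA: tensor_pair A "algebra_of \<phi> B" "algebra_of (\<lambda>x. x) A"
  by (rule tensor_pair.intro[OF module_M module_self[OF A.cring_axioms]])

lemma hom_injective:
  assumes "a \<in> carrier A" "\<phi> a = \<zero>\<^bsub>B\<^esub>"
  shows "a = \<zero>\<^bsub>A\<^esub>"
proof -
  let ?N = "algebra_of (\<lambda>x. x) A" and ?K = "{a \<in> carrier A. \<phi> a = \<zero>\<^bsub>B\<^esub>}"
  have minus: "\<ominus>\<^bsub>?N\<^esub> a = \<ominus>\<^bsub>A\<^esub> a" if "a \<in> carrier A" for a
    using that by (intro abelian_group.minus_equality[OF module.axioms(2)[OF BA.module_N]]) (simp_all add: A.l_neg)
  have K: "submodule ?K A ?N"
    by (rule module.submoduleI[OF BA.module_N]) (auto simp: minus)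
  have zero: "submodule {\<zero>\<^bsub>A\<^esub>} A ?N"
    by (rule module.submoduleI[OF BA.module_N]) (auto simp: minus)
  interpret Z: tensor_pair A "algebra_of \<phi> B" "?N\<lparr>carrier := {\<zero>\<^bsub>A\<^esub>}\<rparr>"
    by (rule tensor_pair.intro[OF module_M submodule_restrict(1)[OF BA.module_N zero]])
  have "?K = {\<zero>\<^bsub>A\<^esub>}"
  proof (rule faithfully_flat_reflects_subset[OF flat BA.module_N _ zero K])
    fix x k assume x: "x \<in> carrier (algebra_of \<phi> B)" and k: "k \<in> ?K"
    \<comment> \<open>The element \<open>k\<close> is moved to the left factor as a scalar, where it
      acts through \<open>\<phi> k\<close>, which is zero.\<close>
    have "BA.pure x k = BA.pure x (k \<odot>\<^bsub>?N\<^esub> \<one>\<^bsub>A\<^esub>)"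
      using k by simp
    also have "\<dots> = BA.pure (k \<odot>\<^bsub>algebra_of \<phi> B\<^esub> x) \<one>\<^bsub>A\<^esub>"
      by (rule BA.pure_smult[symmetric]) (use x k in auto)
    also have "\<dots> = \<zero>\<^bsub>BA.T\<^esub>"
      using x k BA.pure_zero_left[of "\<one>\<^bsub>A\<^esub>"] by simp
    also have "\<dots> = tensor_map A (algebra_of \<phi> B) ?N (\<lambda>x. x) \<zero>\<^bsub>Z.T\<^esub>"
      by (rule tensor_map_zero[OF Z.tensor_pair_axioms BA.tensor_pair_axioms
            submodule_restrict(2)[OF BA.module_N zero], symmetric])
    finally show "BA.pure x k \<in> tensor_map A (algebra_of \<phi> B) ?N (\<lambda>x. x) ` carrier Z.T"
      by blast
  qed (auto intro: inj_on_subset[OF inj_Inl])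
  then show ?thesis using assms by blast
qed

lemma hom_inj_on: "inj_on \<phi> (carrier A)"
proof (rule inj_onI)
  fix x y assume xy: "x \<in> carrier A" "y \<in> carrier A" "\<phi> x = \<phi> y"
  then have "\<phi> (x \<ominus>\<^bsub>A\<^esub> y) = \<zero>\<^bsub>B\<^esub>"
    by (simp add: a_minus_def B.r_neg)
  then have "x \<ominus>\<^bsub>A\<^esub> y = \<zero>\<^bsub>A\<^esub>"
    using xy by (intro hom_injective) simp_all
  then show "x = y"
    using xy A.minus_eq_zeroD by blast
qed

lemma image_eq_equalizer: "{b \<in> carrier B. i1 b = i2 b} = \<phi> ` carrier A"
proof -
  let ?N = "algebra_of \<phi> B" and ?K = "{b \<in> carrier B. i1 b = i2 b}"
  have minus: "\<ominus>\<^bsub>?N\<^esub> b = \<ominus>\<^bsub>B\<^esub> b" if "b \<in> carrier B" for b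
    using that by (intro abelian_group.minus_equality[OF module.axioms(2)[OF module_N]]) (simp_all add: B.l_neg)
  \<comment> \<open>Serves both for closure of the equalizer under scalars from \<open>A\<close> and
    for the inclusion of the image of \<open>\<phi>\<close> in it.\<close>
  have base: "i1 (\<phi> a) = i2 (\<phi> a)" if "a \<in> carrier A" for a
    by (rule tensor_base_change[OF that])
  have K: "submodule ?K A ?N"
    by (rule module.submoduleI[OF module_N]) (auto simp: minus base)
  have im: "submodule (\<phi> ` carrier A) A ?N"
  proof (rule module.submoduleI[OF module_N])
    show "\<zero>\<^bsub>?N\<^esub> \<in> \<phi> ` carrier A"
      by (rule image_eqI[of _ _ "\<zero>\<^bsub>A\<^esub>"]) simp_all
    show "\<ominus>\<^bsub>?N\<^esub> x \<in> \<phi> ` carrier A" if "x \<in> \<phi> ` carrier A" for x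
      using that by (auto simp: minus simp flip: \<phi>.hom_a_inv)
    show "x \<oplus>\<^bsub>?N\<^esub> y \<in> \<phi> ` carrier A" if "x \<in> \<phi> ` carrier A" "y \<in> \<phi> ` carrier A" for x y
      using that by (auto simp flip: \<phi>.hom_add)
    show "a \<odot>\<^bsub>?N\<^esub> x \<in> \<phi> ` carrier A" if "a \<in> carrier A" "x \<in> \<phi> ` carrier A" for a x
      using that by (auto simp flip: \<phi>.hom_mult)
  qed auto
  interpret I: tensor_pair A ?N "?N\<lparr>carrier := \<phi> ` carrier A\<rparr>"
    by (rule tensor_pair.intro[OF module_M submodule_restrict(1)[OF module_N im]])
  \<comment> \<open>The right entry \<open>1\<close> lies in the smaller submodule, so
    \<open>xk \<otimes> 1\<close> comes from the tensor product with the image of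
    \<open>\<phi>\<close>.\<close>
  have one: "\<one>\<^bsub>B\<^esub> \<in> \<phi> ` carrier A"
    by (rule image_eqI[of _ _ "\<one>\<^bsub>A\<^esub>"]) simp_all
  show ?thesis
  proof (rule faithfully_flat_reflects_subset[OF flat module_N _ im K])
    fix x k assume x: "x \<in> carrier (algebra_of \<phi> B)" and k: "k \<in> ?K"
    have "pure x k = i1 x \<otimes>\<^bsub>T\<^esub> i2 k"
      using x k by (simp add: mult_pure)
    also have "i2 k = i1 k"
      using k by simp
    also have "i1 x \<otimes>\<^bsub>T\<^esub> i1 k = pure (x \<otimes>\<^bsub>B\<^esub> k) \<one>\<^bsub>B\<^esub>"
      using x k by (simp add: mult_pure)
    also have "\<dots> = tensor_map A ?N ?N (\<lambda>x. x) (I.pure (x \<otimes>\<^bsub>B\<^esub> k) \<one>\<^bsub>B\<^esub>)"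
      by (rule tensor_map_pure[OF I.tensor_pair_axioms tensor_pair_axioms
            submodule_restrict(2)[OF module_N im], symmetric])
    finally show "pure x k \<in> tensor_map A ?N ?N (\<lambda>x. x) ` carrier I.T"
      using I.pure_closed[of "x \<otimes>\<^bsub>B\<^esub> k" "\<one>\<^bsub>B\<^esub>"] x k one by auto
  qed (auto simp: base intro: inj_on_subset[OF inj_Inr])
qed

sublocale LA: nonzero_divisor_localization A f
  by unfold_locales (rule nzd)

text \<open>Multiplication by \<open>f\<close> is injective on \<open>A\<close>, hence also after
  tensoring with \<open>B\<close>, where it sends \<open>b \<otimes> 1\<close> to
  \<open>(\<phi> f) b \<otimes> 1\<close>. So \<open>b \<otimes> 1\<close> is zero, and
  \<open>pure_one_eq_zeroD\<close> gives \<open>b = 0\<close>.\<close>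

lemma nonzero_divisor_image: "nonzero_divisor B (\<phi> f)"
  unfolding nonzero_divisor_def
proof (intro conjI ballI impI)
  let ?N = "algebra_of (\<lambda>x. x) A"
  let ?u = "\<lambda>a. f \<odot>\<^bsub>?N\<^esub> a"
  fix b assume b: "b \<in> carrier B" and eq: "\<phi> f \<otimes>\<^bsub>B\<^esub> b = \<zero>\<^bsub>B\<^esub>"
  have u: "?u \<in> linear_maps A ?N ?N"
    by (rule smult_linear[OF BA.module_N LA.f_closed])
  have "tensor_map A (algebra_of \<phi> B) ?N ?u (BA.pure b \<one>\<^bsub>A\<^esub>) = BA.pure b (f \<odot>\<^bsub>?N\<^esub> \<one>\<^bsub>A\<^esub>)"
    by (rule tensor_map_pure[OF BA.tensor_pair_axioms BA.tensor_pair_axioms u])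
  also have "\<dots> = BA.pure (f \<odot>\<^bsub>algebra_of \<phi> B\<^esub> b) \<one>\<^bsub>A\<^esub>"
    by (rule BA.pure_smult[symmetric]) (use b in simp_all)
  also have "\<dots> = \<zero>\<^bsub>BA.T\<^esub>"
    using eq BA.pure_zero_left[of "\<one>\<^bsub>A\<^esub>"] by simp
  finally have zero: "tensor_map A (algebra_of \<phi> B) ?N ?u (BA.pure b \<one>\<^bsub>A\<^esub>) = \<zero>\<^bsub>BA.T\<^esub>" .
  have "BA.pure b \<one>\<^bsub>A\<^esub> = \<zero>\<^bsub>BA.T\<^esub>"
  proof (rule faithfully_flat_injective[OF flat BA.module_N _ u _ _ zero])
    \<comment> \<open>\<open>faithfully_flat_injective\<close> asks for values in
      \<open>('a + 'b) set\<close> itself, hence the singletons.\<close>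
    show "inj_on (\<lambda>a. {Inl a :: 'a + 'b}) (carrier ?N)"
      by (auto simp: inj_on_def)
    show "a = \<zero>\<^bsub>?N\<^esub>" if "a \<in> carrier ?N" "?u a = \<zero>\<^bsub>?N\<^esub>" for a
      using that nzd by (simp add: nonzero_divisor_def)
  qed (use b in simp)
  then show "b = \<zero>\<^bsub>B\<^esub>"
    using pure_one_eq_zeroD[OF module_M] b by simp
qed simp

sublocale LB: nonzero_divisor_localization B "\<phi> f"
  by unfold_locales (rule nonzero_divisor_image)

lemma tensor_image_eq: "i1 (\<phi> f) = i2 (\<phi> f)"
  by (rule tensor_base_change[OF LA.f_closed])

lemma nonzero_divisor_tensor: "nonzero_divisor T (i1 (\<phi> f))"
  unfolding nonzero_divisor_def
proof (intro conjI ballI impI)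
  let ?N = "algebra_of \<phi> B"
  define u where "u = (\<lambda>b. f \<odot>\<^bsub>?N\<^esub> b)"
  fix C assume C: "C \<in> carrier T" and eq: "i1 (\<phi> f) \<otimes>\<^bsub>T\<^esub> C = \<zero>\<^bsub>T\<^esub>"
  have u: "u \<in> linear_maps A ?N ?N"
    unfolding u_def by (rule smult_linear[OF module_N LA.f_closed])
  \<comment> \<open>Tensoring \<open>u\<close> with \<open>B\<close> gives multiplication by
    \<open>1 \<otimes> \<phi> f\<close>, which equals \<open>\<phi> f \<otimes> 1\<close>.
    Injectivity of \<open>u\<close> on \<open>B\<close> is
    \<open>nonzero_divisor_image\<close>.\<close>
  have "tensor_map A ?N ?N u D = i1 (\<phi> f) \<otimes>\<^bsub>T\<^esub> D" if "D \<in> carrier T" for D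
    using that
  proof (induction rule: tensor_induct)
    case (pure x y)
    then show ?case
      by (simp only: tensor_map_pure[OF tensor_pair_axioms tensor_pair_axioms u])
        (simp add: tensor_image_eq mult_pure u_def)
  next
    case (add D E)
    then show ?case
      by (simp add: linear_mapsD(2)[OF tensor_map_linear[OF tensor_pair_axioms tensor_pair_axioms u]] tensor_r_distr)
  qed
  then have zero: "tensor_map A ?N ?N u C = \<zero>\<^bsub>T\<^esub>"
    using C eq by simp
  show "C = \<zero>\<^bsub>T\<^esub>"
  proof (rule faithfully_flat_injective[OF flat module_N _ u _ C zero])
    show "inj_on (\<lambda>b. {Inr b :: 'a + 'b}) (carrier ?N)"
      by (auto simp: inj_on_def)
    show "b = \<zero>\<^bsub>?N\<^esub>" if "b \<in> carrier ?N" "u b = \<zero>\<^bsub>?N\<^esub>" for b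
      using that nonzero_divisor_image by (simp add: nonzero_divisor_def u_def)
  qed
qed simp

sublocale LT: nonzero_divisor_localization T "i1 (\<phi> f)"
  by unfold_locales (rule nonzero_divisor_tensor)

text \<open>The same exponent serves in \<open>A\<close>; only the cofactor \<open>c\<close> has to
  be descended, by showing that it lies in the equalizer.\<close>

lemma radical_descends:
  assumes a: "a \<in> carrier A" and rad: "\<phi> a \<in> LB.rad"
  shows "a \<in> LA.rad"
proof -
  obtain n c where n: "n > 0" and c: "c \<in> carrier B" and eq: "\<phi> a [^]\<^bsub>B\<^esub> (n::nat) = c \<otimes>\<^bsub>B\<^esub> \<phi> f"
    using rad unfolding radical_def B.mem_cgenideal by blast
  have power: "\<phi> (a [^]\<^bsub>A\<^esub> n) = c \<otimes>\<^bsub>B\<^esub> \<phi> f"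
    using a eq by (simp add: \<phi>.hom_nat_pow)
  \<comment> \<open>The product of \<open>c\<close> and \<open>\<phi> f\<close> comes from
    \<open>A\<close>, so both maps to \<open>B \<otimes> B\<close> agree on it; cancelling the
    common image of \<open>f\<close> leaves \<open>c\<close>.\<close>
  have "i1 (\<phi> (a [^]\<^bsub>A\<^esub> n)) = i2 (\<phi> (a [^]\<^bsub>A\<^esub> n))"
    by (rule tensor_base_change) (use a in simp)
  then have "i1 (\<phi> f \<otimes>\<^bsub>B\<^esub> c) = i2 (\<phi> f \<otimes>\<^bsub>B\<^esub> c)"
    unfolding power B.m_comm[OF LB.f_closed c] .
  moreover have "i1 (\<phi> f) \<otimes>\<^bsub>T\<^esub> i1 c = i1 (\<phi> f \<otimes>\<^bsub>B\<^esub> c)"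
    using c by simp
  moreover have "i1 (\<phi> f) \<otimes>\<^bsub>T\<^esub> i2 c = i2 (\<phi> f \<otimes>\<^bsub>B\<^esub> c)"
    unfolding tensor_image_eq using c by simp
  ultimately have "i1 (\<phi> f) \<otimes>\<^bsub>T\<^esub> i1 c = i1 (\<phi> f) \<otimes>\<^bsub>T\<^esub> i2 c"
    by (simp only:)
  from LT.powers_cancel[OF LT.f_powers _ _ this] have "i1 c = i2 c"
    using c by simp
  then have "c \<in> \<phi> ` carrier A"
    unfolding image_eq_equalizer[symmetric] using c by simp
  then obtain b where b: "b \<in> carrier A" "c = \<phi> b"
    by blast
  have "a [^]\<^bsub>A\<^esub> n = b \<otimes>\<^bsub>A\<^esub> f"
    by (rule inj_onD[OF hom_inj_on]) (use power a b in simp_all)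
  then show ?thesis
    using a b n unfolding radical_def A.mem_cgenideal by blast
qed

section \<open>The sequence and its exactness\<close>

abbreviation "j \<equiv> localization_map \<phi> B (\<phi> f)"
abbreviation "M0 \<equiv> MO A f"
abbreviation "M1 \<equiv> restrict_scalars \<phi> (MO B (\<phi> f))"
abbreviation "M2 \<equiv> restrict_scalars ((\<lambda>b. i1 b) \<circ> \<phi>) (MO T (i1 (\<phi> f)))"
abbreviation "d x \<equiv> localization_map (\<lambda>b. i1 b) T (i1 (\<phi> f)) x
  \<ominus>\<^bsub>LT.L\<^esub> localization_map (\<lambda>b. i2 b) T (i1 (\<phi> f)) x"

lemma j_frac: "a \<in> carrier A \<Longrightarrow> j (frac A f a f) = frac B (\<phi> f) (\<phi> a) (\<phi> f)"
  by (rule localization_map_frac[OF LA.nonzero_divisor_localization_axioms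
        LB.nonzero_divisor_localization_axioms hom _ LA.f_powers])

lemma d_frac:
  assumes b: "b \<in> carrier B"
  shows "d (frac B (\<phi> f) b (\<phi> f)) = frac T (i1 (\<phi> f)) (i1 b \<ominus>\<^bsub>T\<^esub> i2 b) (i1 (\<phi> f))"
proof -
  have "localization_map (\<lambda>b. i1 b) T (i1 (\<phi> f)) (frac B (\<phi> f) b (\<phi> f)) = frac T (i1 (\<phi> f)) (i1 b) (i1 (\<phi> f))"
    by (rule localization_map_frac[OF LB.nonzero_divisor_localization_axioms
          LT.nonzero_divisor_localization_axioms tensor_left_hom b LB.f_powers])
  moreover have "localization_map (\<lambda>b. i2 b) T (i1 (\<phi> f)) (frac B (\<phi> f) b (\<phi> f)) = frac T (i1 (\<phi> f)) (i2 b) (i1 (\<phi> f))"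
    \<comment> \<open>\<open>localization_map_frac\<close> needs the target localized at the image
      of \<open>\<phi> f\<close> under the map in question, here \<open>i2\<close>.\<close>
    unfolding tensor_image_eq
    by (rule localization_map_frac[OF LB.nonzero_divisor_localization_axioms
          LT.nonzero_divisor_localization_axioms[unfolded tensor_image_eq] tensor_right_hom b LB.f_powers])
  ultimately show ?thesis
    using b by (simp add: LT.frac_minus_same)
qed

lemma modules: "module A M0" "module A M1" "module A M2"
proof -
  show "module A M0" by (rule LA.MO_module)
  show "module A M1"
    by (rule restrict_scalars_module[OF A.cring_axioms hom LB.MO_module])
  have "(\<lambda>b. i1 b) \<circ> \<phi> \<in> ring_hom A T"
    by (rule ring_hom_trans[OF hom tensor_left_hom])
  then show "module A M2"
    by (rule restrict_scalars_module[OF A.cring_axioms _ LT.MO_module])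
qed

lemma radical_tensor:
  assumes "b \<in> LB.rad"
  shows "i1 b \<in> LT.rad" "i2 b \<in> LT.rad" "i1 b \<ominus>\<^bsub>T\<^esub> i2 b \<in> LT.rad"
proof -
  show 1: "i1 b \<in> LT.rad"
    by (rule radical_cgenideal_hom[OF B.cring_axioms tensor_cring tensor_left_hom LB.f_closed assms])
  show 2: "i2 b \<in> LT.rad"
    unfolding tensor_image_eq
    by (rule radical_cgenideal_hom[OF B.cring_axioms tensor_cring tensor_right_hom LB.f_closed assms])
  have "\<ominus>\<^bsub>T\<^esub> i2 b = (\<ominus>\<^bsub>T\<^esub> \<one>\<^bsub>T\<^esub>) \<otimes>\<^bsub>T\<^esub> i2 b"
    using assms by (simp add: Tring.l_minus)
  also have "\<dots> \<in> LT.rad"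
    by (rule LT.rad_ideal(3)[OF _ 2]) simp
  finally show "i1 b \<ominus>\<^bsub>T\<^esub> i2 b \<in> LT.rad"
    unfolding a_minus_def by (rule LT.rad_ideal(2)[OF 1])
qed

lemma j_linear: "j \<in> linear_maps A M0 M1"
proof (rule linear_mapsI)
  show "j x \<in> carrier M1" if "x \<in> carrier M0" for x
    using that radical_cgenideal_hom[OF A.cring_axioms B.cring_axioms hom LA.f_closed]
    by (auto simp: LA.MO_simps LB.MO_simps j_frac)
  show "j (x \<oplus>\<^bsub>M0\<^esub> y) = j x \<oplus>\<^bsub>M1\<^esub> j y" if "x \<in> carrier M0" "y \<in> carrier M0" for x y
    using that by (auto simp: LA.MO_simps LB.MO_simps j_frac LA.frac_add_same LB.frac_add_same)
  show "j (a \<odot>\<^bsub>M0\<^esub> x) = a \<odot>\<^bsub>M1\<^esub> j x" if "a \<in> carrier A" "x \<in> carrier M0" for a x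
    using that by (auto simp: LA.MO_simps LB.MO_simps j_frac LA.frac_smult LB.frac_smult)
qed

lemma d_linear: "(\<lambda>x. d x) \<in> linear_maps A M1 M2"
proof (rule linear_mapsI)
  show "d x \<in> carrier M2" if "x \<in> carrier M1" for x
    using that radical_tensor(3) by (auto simp: LB.MO_simps LT.MO_simps d_frac)
  show "d (x \<oplus>\<^bsub>M1\<^esub> y) = d x \<oplus>\<^bsub>M2\<^esub> d y" if xy: "x \<in> carrier M1" "y \<in> carrier M1" for x y
  proof -
    obtain b c where bc: "b \<in> LB.rad" "c \<in> LB.rad" and x: "x = frac B (\<phi> f) b (\<phi> f)" and y: "y = frac B (\<phi> f) c (\<phi> f)"
      using xy by (auto simp: LB.MO_simps)
    have "i1 (b \<oplus>\<^bsub>B\<^esub> c) \<ominus>\<^bsub>T\<^esub> i2 (b \<oplus>\<^bsub>B\<^esub> c) = (i1 b \<ominus>\<^bsub>T\<^esub> i2 b) \<oplus>\<^bsub>T\<^esub> (i1 c \<ominus>\<^bsub>T\<^esub> i2 c)"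
      using bc by (simp add: a_minus_def T.minus_add T.a_ac)
    then have "d (frac B (\<phi> f) (b \<oplus>\<^bsub>B\<^esub> c) (\<phi> f)) = d x \<oplus>\<^bsub>LT.L\<^esub> d y"
      using bc unfolding x y by (simp only: d_frac LB.rad_closed B.a_closed)
        (simp add: LT.frac_add_same)
    then show ?thesis
      using bc by (simp add: x y LB.MO_simps LT.MO_simps LB.frac_add_same)
  qed
  show "d (a \<odot>\<^bsub>M1\<^esub> x) = a \<odot>\<^bsub>M2\<^esub> d x" if a: "a \<in> carrier A" and x: "x \<in> carrier M1" for a x
  proof -
    obtain b where b: "b \<in> LB.rad" and x: "x = frac B (\<phi> f) b (\<phi> f)"
      using x by (auto simp: LB.MO_simps)
    have "i1 (\<phi> a \<otimes>\<^bsub>B\<^esub> b) \<ominus>\<^bsub>T\<^esub> i2 (\<phi> a \<otimes>\<^bsub>B\<^esub> b) = i1 (\<phi> a) \<otimes>\<^bsub>T\<^esub> i1 b \<ominus>\<^bsub>T\<^esub> i2 (\<phi> a) \<otimes>\<^bsub>T\<^esub> i2 b"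
      using a b by simp
    \<comment> \<open>Both maps agree on \<open>\<phi> a\<close>, so this scalar can be taken out of
      the difference.\<close>
    also have "\<dots> = i1 (\<phi> a) \<otimes>\<^bsub>T\<^esub> (i1 b \<ominus>\<^bsub>T\<^esub> i2 b)"
      using a b by (simp only: tensor_base_change[OF a, symmetric]) (simp add: a_minus_def Tring.r_distr Tring.r_minus)
    finally have "d (frac B (\<phi> f) (\<phi> a \<otimes>\<^bsub>B\<^esub> b) (\<phi> f)) = i1 (\<phi> a) \<odot>\<^bsub>LT.L\<^esub> d x"
      using a b unfolding x by (simp only: d_frac LB.rad_closed B.m_closed \<phi>.hom_closed)
        (simp add: LT.frac_smult)
    then show ?thesis
      using a b by (simp add: x LB.MO_simps LT.MO_simps LB.frac_smult)
  qed
qed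

text \<open>This exactness expresses injectivity of \<open>j\<close>. It reduces to injectivity of
  \<open>\<phi>\<close> on numerators, because a fraction over a nonzero divisor vanishes only with
  its numerator.\<close>

lemma exact_left: "exact A zero_module M0 M1 (\<lambda>_. \<zero>\<^bsub>M0\<^esub>) j"
proof (rule exactI[OF module_zero_module[OF A.cring_axioms] modules(1,2) _ j_linear])
  interpret M0: module A M0 by (rule modules(1))
  show "(\<lambda>_. \<zero>\<^bsub>M0\<^esub>) \<in> linear_maps A zero_module M0"
    by (rule linear_mapsI) simp_all
  show "j \<zero>\<^bsub>M0\<^esub> = \<zero>\<^bsub>M1\<^esub>"
    by (rule linear_maps_zero[OF modules(1,2) j_linear])
  show "x \<in> (\<lambda>_. \<zero>\<^bsub>M0\<^esub>) ` carrier zero_module" if x: "x \<in> carrier M0" and 0: "j x = \<zero>\<^bsub>M1\<^esub>" for x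
  proof -
    obtain a where a: "a \<in> LA.rad" "x = frac A f a f"
      using x by (auto simp: LA.MO_simps)
    then have "\<phi> a = \<zero>\<^bsub>B\<^esub>"
      using 0 by (simp add: j_frac LB.MO_simps LB.frac_eq_zero_iff)
    then have "a = \<zero>\<^bsub>A\<^esub>"
      using a hom_injective by simp
    then show ?thesis
      using a LA.frac_zero[OF LA.f_powers] by (simp add: LA.MO_simps zero_module_def)
  qed
qed

lemma exact_middle: "exact A M0 M1 M2 j (\<lambda>x. d x)"
proof (rule exactI[OF modules j_linear d_linear])
  \<comment> \<open>The difference is a single fraction over the image of \<open>f\<close>, so it
    vanishes exactly when its numerator does.\<close>
  have d_zero: "d (frac B (\<phi> f) b (\<phi> f)) = \<zero>\<^bsub>M2\<^esub> \<longleftrightarrow> i1 b = i2 b" if b: "b \<in> carrier B" for b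
  proof -
    have "i1 b \<ominus>\<^bsub>T\<^esub> i2 b = \<zero>\<^bsub>T\<^esub> \<longleftrightarrow> i1 b = i2 b"
      using b T.minus_eq_zeroD[of "i1 b" "i2 b"] by (auto simp: a_minus_def T.r_neg)
    then show ?thesis
      unfolding d_frac[OF b] using b by (simp add: LT.MO_simps LT.frac_eq_zero_iff)
  qed
  show "d (j x) = \<zero>\<^bsub>M2\<^esub>" if x: "x \<in> carrier M0" for x
  proof -
    obtain a where a: "a \<in> LA.rad" "x = frac A f a f"
      using x by (auto simp: LA.MO_simps)
    then have "i1 (\<phi> a) = i2 (\<phi> a)"
      by (intro tensor_base_change) simp
    then show ?thesis
      using a d_zero[of "\<phi> a"] by (simp only: j_frac LA.rad_closed \<phi>.hom_closed)
  qed
  show "x \<in> j ` carrier M0" if x: "x \<in> carrier M1" and 0: "d x = \<zero>\<^bsub>M2\<^esub>" for x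
  proof -
    obtain b where b: "b \<in> LB.rad" and x: "x = frac B (\<phi> f) b (\<phi> f)"
      using x by (auto simp: LB.MO_simps)
    have "i1 b = i2 b"
      using 0 unfolding x by (rule iffD1[OF d_zero[OF LB.rad_closed[OF b]]])
    then have "b \<in> \<phi> ` carrier A"
      unfolding image_eq_equalizer[symmetric] using b by simp
    then obtain a where a: "a \<in> carrier A" "b = \<phi> a"
      by blast
    \<comment> \<open>A preimage in \<open>A\<close> is not enough: membership in \<open>M0\<close>
      also requires the numerator to lie in the radical of \<open>(f)\<close> in
      \<open>A\<close>.\<close>
    then have "a \<in> LA.rad"
      using b radical_descends by simp
    then show ?thesis
      using a by (auto simp: x LA.MO_simps j_frac intro!: image_eqI[of _ _ "frac A f a f"])
  qed
qed

end

theorem proposition3p4: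
  fixes A :: "('a, 'r) ring_scheme" and B :: "('b, 's) ring_scheme"
    and \<phi> :: "'a \<Rightarrow> 'b" and f :: 'a
  assumes "cring A" and "cring B"
    and "nonzero_divisor A f"
    and "faithfully_flat_hom A B \<phi>"
  shows "let BA = algebra_of \<phi> B;
             BB = tensor A BA BA;
             i1 = (\<lambda>b. pure_tensor A BA BA b \<one>\<^bsub>B\<^esub>);
             i2 = (\<lambda>b. pure_tensor A BA BA \<one>\<^bsub>B\<^esub> b);
             g = \<phi> f;
             h = i1 g;
             M0 = MO A f;
             M1 = restrict_scalars \<phi> (MO B g);
             M2 = restrict_scalars (i1 \<circ> \<phi>) (MO BB h);
             j = localization_map \<phi> B g;
             d = (\<lambda>x. localization_map i1 BB h x \<ominus>\<^bsub>localization BB h\<^esub> localization_map i2 BB h x)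
         in nonzero_divisor B g \<and> nonzero_divisor BB h \<and> h = i2 g \<and>
            exact A zero_module M0 M1 (\<lambda>_. \<zero>\<^bsub>M0\<^esub>) j \<and>
            exact A M0 M1 M2 j d"
proof -
  interpret faithfully_flat_extension A B \<phi> f
    using assms by (intro faithfully_flat_extension.intro faithfully_flat_extension_axioms.intro)
  show ?thesis
    unfolding Let_def
    by (intro conjI nonzero_divisor_image nonzero_divisor_tensor tensor_image_eq exact_left exact_middle)
qed

end
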